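(* Let $\pi:(X,T)\to(Y,T)$ be a nontrivial RIC weakly mixing extension of minimal t.d.s. Then there exists a dense $G_\delta$ subset $\Omega$ of $X$ such that for every $x\in\Omega$, $\pi^{-1}(\pi(x))$ is a $\Delta$-transitive set in $(X,T)$.
   Context: A t.d.s. $(X,T)$ is a compact metric space $X$ with a homeomorphism $T$; minimal: every orbit is dense; an extension (factor map) is a continuous equivariant surjection, nontrivial if it is not an isomorphism. $\mathbb{N}=\{1,2,\dots\}$. $R_\pi=\{(x,x'):\pi(x)=\pi(x')\}$, $R_\pi^n=\{(x_1,\dots,x_n):\pi(x_1)=\cdots=\pi(x_n)\}$. $\pi$ is weakly mixing if $(R_\pi,T\times T)$ is transitive (for non-empty relatively open $U,V$ some $n\in\mathbb{Z}$ satisfies $U\cap(T\times T)^{-n}V\ne\emptyset$). $\pi$ is RIC if, for a minimal left ideal $M$ of $\beta\mathbb{Z}$, an idempotent $u\in M$ and $y_0\in Y$ with $uy_0=y_0$, one has $\pi^{-1}(py_0)=p\circ u\pi^{-1}(y_0)$ for all $p\in M$, where $p\circ A=\lim_\lambda T^{m_\lambda}A$ in the Hausdorff topology on closed subsets for a net $m_\lambda\to p$ in $\beta\mathbb{Z}$; equivalently, $\pi$ is open and for every $n\ge1$ the minimal points are dense in $R_\pi^n$. For subsets $U_0,\dots,U_d$ of $X$ let $N(U_0,\dots,U_d)=\{n\in\mathbb{N}:\bigcap_{i=0}^dT^{-in}U_i\neq\emptyset\}$. A closed set $A\subseteq X$ is a $\Delta$-transitive set if for every $d\in\mathbb{N}$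 and all non-empty open $U_0,\dots,U_d$ of $X$ intersecting $A$, $N(U_0\cap A,U_1,\dots,U_d)\neq\emptyset$. *)

theory Defs
  imports "HOL-Analysis.Analysis"
begin

section \<open>Topological dynamical systems\<close>

text \<open>
  The phase space of a system is the whole universe of a metric space type; a system is
  therefore given by its transformation alone, and it is automatically nonempty.
\<close>

definition tds :: "('a::metric_space \<Rightarrow> 'a) \<Rightarrow> bool" where
  "tds T \<longleftrightarrow> compact (UNIV :: 'a set) \<and> (\<exists>T'. homeomorphism UNIV UNIV T T')"

definition iter :: "('a \<Rightarrow> 'a) \<Rightarrow> int \<Rightarrow> 'a \<Rightarrow> 'a" where
  "iter T n = (if 0 \<le> n then T ^^ nat n else inv T ^^ nat (- n))"

definition minimal_tds :: "('a::metric_space \<Rightarrow> 'a) \<Rightarrow> bool" where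
  "minimal_tds T \<longleftrightarrow> tds T \<and> (\<forall>x. closure (range (\<lambda>n. iter T n x)) = UNIV)"

definition extension ::
    "('a::metric_space \<Rightarrow> 'a) \<Rightarrow> ('b::metric_space \<Rightarrow> 'b) \<Rightarrow> ('a \<Rightarrow> 'b) \<Rightarrow> bool" where
  "extension T S \<pi> \<longleftrightarrow> continuous_on UNIV \<pi> \<and> surj \<pi> \<and> \<pi> \<circ> T = S \<circ> \<pi>"

definition isomorphism ::
    "('a::metric_space \<Rightarrow> 'a) \<Rightarrow> ('b::metric_space \<Rightarrow> 'b) \<Rightarrow> ('a \<Rightarrow> 'b) \<Rightarrow> bool" where
  "isomorphism T S \<pi> \<longleftrightarrow>
     extension T S \<pi> \<and> (\<exists>\<rho>. extension S T \<rho> \<and> \<rho> \<circ> \<pi> = id \<and> \<pi> \<circ> \<rho> = id)"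

definition nontrivial_extension ::
    "('a::metric_space \<Rightarrow> 'a) \<Rightarrow> ('b::metric_space \<Rightarrow> 'b) \<Rightarrow> ('a \<Rightarrow> 'b) \<Rightarrow> bool" where
  "nontrivial_extension T S \<pi> \<longleftrightarrow> extension T S \<pi> \<and> \<not> isomorphism T S \<pi>"

section \<open>Weakly mixing extensions\<close>

definition fiber_rel :: "('a \<Rightarrow> 'b) \<Rightarrow> ('a \<times> 'a) set" where
  "fiber_rel \<pi> = {(x, x'). \<pi> x = \<pi> x'}"

definition transitive_on :: "'a::topological_space set \<Rightarrow> ('a \<Rightarrow> 'a) \<Rightarrow> bool" where
  "transitive_on Z F \<longleftrightarrow>
     (\<forall>U V. openin (top_of_set Z) U \<and> U \<noteq> {} \<and> openin (top_of_set Z) V \<and> V \<noteq> {} \<longrightarrow>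
        (\<exists>n::int. U \<inter> iter F n -` V \<noteq> {}))"

definition weakly_mixing_extension ::
    "('a::metric_space \<Rightarrow> 'a) \<Rightarrow> ('a \<Rightarrow> 'b) \<Rightarrow> bool" where
  "weakly_mixing_extension T \<pi> \<longleftrightarrow> transitive_on (fiber_rel \<pi>) (map_prod T T)"

section \<open>The semigroup of ultrafilters on the integers\<close>

definition betaZ :: "int filter set" where
  "betaZ = {p. p \<noteq> bot \<and> (\<forall>P. eventually P p \<or> eventually (\<lambda>n. \<not> P n) p)}"

text \<open>
  The order of the two limits is the one for which \<open>bz_add p q\<close> acts as \<open>q\<close> followed by \<open>p\<close>,
  so that \<open>p \<mapsto> bz_add p q\<close> is continuous.
\<close>

definition bz_add :: "int filter \<Rightarrow> int filter \<Rightarrow> int filter" where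
  "bz_add p q = Abs_filter (\<lambda>P. eventually (\<lambda>m. eventually (\<lambda>n. P (m + n)) q) p)"

lemma eventually_bz_add:
  "eventually P (bz_add p q) \<longleftrightarrow> eventually (\<lambda>m. eventually (\<lambda>n. P (m + n)) q) p"
  unfolding bz_add_def
proof (rule eventually_Abs_filter, rule is_filter.intro)
  show "\<forall>\<^sub>F m in p. \<forall>\<^sub>F n in q. True"
    by simp
next
  fix P Q :: "int \<Rightarrow> bool"
  assume "\<forall>\<^sub>F m in p. \<forall>\<^sub>F n in q. P (m + n)" and "\<forall>\<^sub>F m in p. \<forall>\<^sub>F n in q. Q (m + n)"
  then show "\<forall>\<^sub>F m in p. \<forall>\<^sub>F n in q. P (m + n) \<and> Q (m + n)"
    by eventually_elim (rule eventually_conj)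
next
  fix P Q :: "int \<Rightarrow> bool"
  assume "\<forall>n. P n \<longrightarrow> Q n" and "\<forall>\<^sub>F m in p. \<forall>\<^sub>F n in q. P (m + n)"
  then show "\<forall>\<^sub>F m in p. \<forall>\<^sub>F n in q. Q (m + n)"
    by (auto elim!: eventually_mono)
qed

definition left_ideal :: "int filter set \<Rightarrow> bool" where
  "left_ideal M \<longleftrightarrow> M \<noteq> {} \<and> M \<subseteq> betaZ \<and> (\<forall>p\<in>betaZ. \<forall>q\<in>M. bz_add p q \<in> M)"

definition minimal_left_ideal :: "int filter set \<Rightarrow> bool" where
  "minimal_left_ideal M \<longleftrightarrow> left_ideal M \<and> (\<forall>L. left_ideal L \<and> L \<subseteq> M \<longrightarrow> L = M)"

definition bz_act :: "('a::t2_space \<Rightarrow> 'a) \<Rightarrow> int filter \<Rightarrow> 'a \<Rightarrow> 'a" where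
  "bz_act T p x = Lim p (\<lambda>m. iter T m x)"

section \<open>The circle operation and RIC extensions\<close>

text \<open>Only meaningful for nonempty bounded sets.\<close>

definition hausdorff_dist :: "'a::metric_space set \<Rightarrow> 'a set \<Rightarrow> real" where
  "hausdorff_dist A B = max (SUP a\<in>A. infdist a B) (SUP b\<in>B. infdist b A)"

text \<open>
  Since \<open>p\<close> is an ultrafilter, the limit along \<open>p\<close> is the limit along any net of integers
  converging to \<open>p\<close> in the Stone-Cech compactification. The closure is there because the
  circle operation is applied to sets that need not be closed.
\<close>

definition circ :: "('a::metric_space \<Rightarrow> 'a) \<Rightarrow> int filter \<Rightarrow> 'a set \<Rightarrow> 'a set" where
  "circ T p A = (THE C. closed C \<and> C \<noteq> {} \<and>
     ((\<lambda>m. hausdorff_dist (iter T m ` closure A) C) \<longlongrightarrow> 0) p)"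

text \<open>
  The condition does not depend on the choice of \<open>M\<close>, \<open>u\<close> and \<open>y0\<close>, and such a choice always
  exists; requiring it for one choice is the formally weakest version.
\<close>

definition RIC_extension ::
    "('a::metric_space \<Rightarrow> 'a) \<Rightarrow> ('b::metric_space \<Rightarrow> 'b) \<Rightarrow> ('a \<Rightarrow> 'b) \<Rightarrow> bool" where
  "RIC_extension T S \<pi> \<longleftrightarrow>
     (\<exists>M u y0. minimal_left_ideal M \<and> u \<in> M \<and> bz_add u u = u \<and> bz_act S u y0 = y0 \<and>
        (\<forall>p\<in>M. \<pi> -` {bz_act S p y0} = circ T p (bz_act T u ` (\<pi> -` {y0}))))"

section \<open>Delta-transitive sets\<close>

definition return_times :: "('a \<Rightarrow> 'a) \<Rightarrow> nat \<Rightarrow> (nat \<Rightarrow> 'a set) \<Rightarrow> nat set" where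
  "return_times T d U = {n. 1 \<le> n \<and> (\<Inter>i\<le>d. (T ^^ (i * n)) -` U i) \<noteq> {}}"

definition Delta_transitive_set :: "('a::topological_space \<Rightarrow> 'a) \<Rightarrow> 'a set \<Rightarrow> bool" where
  "Delta_transitive_set T A \<longleftrightarrow> closed A \<and>
     (\<forall>d\<ge>1. \<forall>U. (\<forall>i\<le>d. open (U i) \<and> U i \<inter> A \<noteq> {}) \<longrightarrow>
        return_times T d (U(0 := U 0 \<inter> A)) \<noteq> {})"

end

theory Submission
  imports Defs
begin

text \<open>
  Consider the closure of all progressions \<open>(T\<^sup>i\<^sup>n x)\<close>, \<open>i \<in> I\<close>, with \<open>x\<close> and \<open>n\<close> arbitrary. By an
  argument of Glasner it is minimal under the \<open>\<int>\<^sup>2\<close>-action by \<open>T\<^sup>m\<^sup>+\<^sup>i\<^sup>n\<close> on coordinate \<open>i\<close>. The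
  point is that it is saturated: each coordinate may be changed arbitrarily inside its fibre.
  A tuple with all entries in one fibre then lies in the closure, so open sets meeting a common
  fibre have a common return time, and a Baire argument (\<open>\<pi>\<close> is open) gives \<open>\<Omega>\<close>.

  Saturation is proved by induction on \<open>I\<close>. To change coordinate \<open>j\<close>, pick \<open>l \<noteq> j\<close> and let \<open>T\<^sup>i\<^sup>-\<^sup>l\<close> act
  on coordinate \<open>i\<close>, which leaves coordinate \<open>l\<close> alone; take a minimal idempotent \<open>w\<close> acting on
  coordinate \<open>j\<close> and a fibre over a point that \<open>w\<close> fixes. By induction every \<open>w\<close>-fixed value \<open>a\<close> at \<open>j\<close> is
  compatible with some entry \<open>x\<close> at \<open>l\<close>. The \<open>w\<close>-fixed points of the fibre are irreducible for the
  closure operator induced by \<open>w\<close>, hence one \<open>x\<close> works for all \<open>a\<close>, and RIC extends this to the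
  whole fibre. By minimality it then holds at every tuple.

  Irreducibility is where weak mixing enters: a pair with dense orbit in the fibre relation is
  proximal, so it can be taken as \<open>(x, u x)\<close> with \<open>u\<close> a minimal idempotent, and any two fixed points
  are images \<open>p x\<close>, \<open>p u x\<close> of it. By RIC \<open>x\<close> is a limit of \<open>u\<close>-fixed points, and this limit cannot
  separate \<open>x\<close> from \<open>u x\<close>.
\<close>

section \<open>Ultrafilters and idempotents\<close>

definition ultra :: "'g filter \<Rightarrow> bool" where
  "ultra p \<longleftrightarrow> p \<noteq> bot \<and> (\<forall>P. eventually P p \<or> eventually (\<lambda>n. \<not> P n) p)"

lemma betaZ_eq: "betaZ = Collect ultra"
  by (auto simp: betaZ_def ultra_def)

lemma ultra_not: "ultra p \<Longrightarrow> eventually (\<lambda>n. \<not> P n) p \<longleftrightarrow> \<not> eventually P p"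
  using eventually_conj[of P p "\<lambda>n. \<not> P n"] by (auto simp: ultra_def eventually_False)

lemma ultra_frequently: "ultra p \<Longrightarrow> frequently P p \<longleftrightarrow> eventually P p"
  by (simp add: frequently_def ultra_not)

lemma ultra_disj:
  "ultra p \<Longrightarrow> eventually (\<lambda>n. P n \<or> Q n) p \<longleftrightarrow> eventually P p \<or> eventually Q p"
  by (simp add: frequently_disj_iff flip: ultra_frequently)

lemma ultra_Bex_finite:
  assumes "ultra p" "finite I" "eventually (\<lambda>n. \<exists>i\<in>I. P i n) p"
  shows "\<exists>i\<in>I. eventually (P i) p"
  using assms(2,3)
proof (induction I)
  case empty
  then show ?case using assms(1) by (simp add: ultra_def)
next
  case (insert i I)
  then show ?case using assms(1) by (auto simp: ultra_disj)
qed

lemma ultra_nonbot: "ultra p \<Longrightarrow> p \<noteq> bot"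
  by (simp add: ultra_def)

lemma ultra_le_eq:
  assumes "ultra p" "q \<noteq> bot" "q \<le> p"
  shows "q = p"
proof (rule antisym[OF assms(3)], rule filter_leI, rule ccontr)
  fix P assume "eventually P q" "\<not> eventually P p"
  then have "eventually (\<lambda>n. \<not> P n) q"
    using assms by (auto simp: le_filter_def simp flip: ultra_not)
  with \<open>eventually P q\<close> have "eventually (\<lambda>n. False) q"
    by eventually_elim auto
  then show False using assms(2) by (simp add: eventually_False)
qed

lemma ultra_filtermap: "ultra p \<Longrightarrow> ultra (filtermap f p)"
  by (simp add: ultra_def eventually_filtermap filtermap_bot_iff)

text \<open>The order is read downwards because a smaller filter stands for a smaller closed set of
  ultrafilters. Applied to all proper filters it yields ultrafilters; applied to closed
  subsemigroups it yields a minimal one.\<close>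

lemma filter_Zorn:
  fixes A :: "'g filter set"
  assumes F: "F \<in> A"
    and chain: "\<And>C. C \<subseteq> A \<Longrightarrow> C \<noteq> {} \<Longrightarrow> (\<And>a b. a \<in> C \<Longrightarrow> b \<in> C \<Longrightarrow> a \<le> b \<or> b \<le> a) \<Longrightarrow> Inf C \<in> A"
  shows "\<exists>m\<in>A. m \<le> F \<and> (\<forall>a\<in>A. a \<le> m \<longrightarrow> a = m)"
proof -
  let ?B = "{a \<in> A. a \<le> F}"
  have "\<exists>m\<in>?B. \<forall>a\<in>?B. a \<le> m \<longrightarrow> a = m"
  proof (rule predicate_Zorn[of ?B "\<lambda>a b. b \<le> a"])
    show "partial_order_on ?B (relation_of (\<lambda>a b. b \<le> a) ?B)"
      by (rule partial_order_on_relation_ofI) auto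
  next
    fix C assume C: "C \<in> Chains (relation_of (\<lambda>a b. b \<le> a) ?B)"
    then have sub: "C \<subseteq> ?B" and lin: "\<And>a b. a \<in> C \<Longrightarrow> b \<in> C \<Longrightarrow> a \<le> b \<or> b \<le> a"
      by (auto simp: Chains_def relation_of_def)
    show "\<exists>u\<in>?B. \<forall>a\<in>C. u \<le> a"
    proof (cases "C = {}")
      case True
      then show ?thesis using F by auto
    next
      case False
      then have "Inf C \<in> A" using chain[of C] sub lin by auto
      moreover have "Inf C \<le> F" using False sub by (auto intro: Inf_lower2)
      ultimately show ?thesis by (auto intro: Inf_lower)
    qed
  qed
  then show ?thesis by (metis (mono_tags, lifting) mem_Collect_eq order_trans)
qed

text \<open>A chain is a filter base of its infimum, so the false predicate would already hold
  eventually along a single member. This plays the role of compactness of the space of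
  ultrafilters.\<close>

lemma Inf_chain_nonbot:
  fixes C :: "'g filter set"
  assumes "C \<noteq> {}" "\<And>a b. a \<in> C \<Longrightarrow> b \<in> C \<Longrightarrow> a \<le> b \<or> b \<le> a" "bot \<notin> C"
  shows "Inf C \<noteq> bot"
proof -
  have "eventually (\<lambda>x. False) (Inf C) \<longleftrightarrow> (\<exists>b\<in>C. eventually (\<lambda>x. False) b)"
  proof (rule eventually_Inf_base[OF assms(1)])
    fix F G assume "F \<in> C" "G \<in> C"
    with assms(2)[of F G] show "\<exists>x\<in>C. x \<le> inf F G" by auto
  qed
  then show ?thesis using assms(3) by (auto simp: eventually_False)
qed

lemma ex_ultra_le:
  assumes "F \<noteq> bot"
  shows "\<exists>p. ultra p \<and> p \<le> F"
proof -
  have "\<exists>m\<in>{a. a \<noteq> bot}. m \<le> F \<and> (\<forall>a\<in>{a. a \<noteq> bot}. a \<le> m \<longrightarrow> a = m)"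
  proof (rule filter_Zorn)
    show "F \<in> {a. a \<noteq> bot}" using assms by simp
    fix C :: "'a filter set"
    assume "C \<subseteq> {a. a \<noteq> bot}" "C \<noteq> {}" "\<And>a b. a \<in> C \<Longrightarrow> b \<in> C \<Longrightarrow> a \<le> b \<or> b \<le> a"
    then show "Inf C \<in> {a. a \<noteq> bot}" using Inf_chain_nonbot[of C] by auto
  qed
  then obtain m where m: "m \<noteq> bot" "m \<le> F" "\<And>a. a \<noteq> bot \<Longrightarrow> a \<le> m \<Longrightarrow> a = m"
    by auto
  have "eventually P m \<or> eventually (\<lambda>n. \<not> P n) m" for P
  proof (rule disjCI)
    assume "\<not> eventually (\<lambda>n. \<not> P n) m"
    then have "inf m (principal {n. P n}) \<noteq> bot"
      by (simp add: trivial_limit_def eventually_inf_principal)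
    then have "inf m (principal {n. P n}) = m" using m(3) by simp
    then have "m \<le> principal {n. P n}" by (metis inf_le2)
    then show "eventually P m" by (simp add: le_principal)
  qed
  then show ?thesis using m(1,2) by (auto simp: ultra_def)
qed

text \<open>A filter is determined by the ultrafilters refining it: if \<open>P\<close> failed,
  adding its complement to \<open>F\<close> would leave a proper filter, and an ultrafilter below
  that contradicts the assumption.\<close>

lemma eventually_ultraI:
  assumes "\<And>p. ultra p \<Longrightarrow> p \<le> F \<Longrightarrow> eventually P p"
  shows "eventually P F"
proof (rule ccontr)
  assume "\<not> eventually P F"
  then have "inf F (principal {n. \<not> P n}) \<noteq> bot"
    by (simp add: trivial_limit_def eventually_inf_principal)
  then obtain p where p: "ultra p" "p \<le> inf F (principal {n. \<not> P n})"
    using ex_ultra_le by blast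
  then have "eventually (\<lambda>n. \<not> P n) p" "p \<le> F" by (auto simp: le_principal)
  then show False using assms p(1) by (auto simp: ultra_not)
qed

text \<open>The limit of the points \<open>q i\<close> along \<open>F\<close> in the Stone-Cech
  compactification.\<close>

definition ubind :: "'i filter \<Rightarrow> ('i \<Rightarrow> 'g filter) \<Rightarrow> 'g filter" where
  "ubind F q = Abs_filter (\<lambda>P. eventually (\<lambda>i. eventually P (q i)) F)"

lemma eventually_ubind:
  "eventually P (ubind F q) \<longleftrightarrow> eventually (\<lambda>i. eventually P (q i)) F"
  unfolding ubind_def
  by (rule eventually_Abs_filter, rule is_filter.intro)
    (auto simp: eventually_conj_iff elim!: eventually_mono)

lemma ultra_ubind:
  assumes "ultra F" "\<And>i. ultra (q i)"
  shows "ultra (ubind F q)"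
  unfolding ultra_def
proof (intro conjI allI)
  show "ubind F q \<noteq> bot"
    using assms by (simp add: trivial_limit_def eventually_ubind ultra_def)
  show "eventually P (ubind F q) \<or> eventually (\<lambda>n. \<not> P n) (ubind F q)" for P
    using assms by (simp add: eventually_ubind ultra_not)
qed

text \<open>The operation \<open>bz_add\<close> over an arbitrary additive type; the progression
  argument needs it on \<int> \<times> \<int>.\<close>

definition uadd :: "'g::plus filter \<Rightarrow> 'g filter \<Rightarrow> 'g filter" where
  "uadd p q = ubind p (\<lambda>m. filtermap (\<lambda>n. m + n) q)"

lemma eventually_uadd:
  "eventually P (uadd p q) \<longleftrightarrow> eventually (\<lambda>m. eventually (\<lambda>n. P (m + n)) q) p"
  by (simp add: uadd_def eventually_ubind eventually_filtermap)

lemma bz_add_eq: "bz_add = uadd"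
  by (simp add: fun_eq_iff filter_eq_iff eventually_bz_add eventually_uadd)

lemma uadd_nonbot: "p \<noteq> bot \<Longrightarrow> q \<noteq> bot \<Longrightarrow> uadd p q \<noteq> bot"
  by (simp add: trivial_limit_def eventually_uadd)

lemma ultra_uadd: "ultra p \<Longrightarrow> ultra q \<Longrightarrow> ultra (uadd p q)"
  unfolding uadd_def by (intro ultra_ubind ultra_filtermap)

lemma uadd_assoc: "uadd (uadd p q) (r :: 'g::semigroup_add filter) = uadd p (uadd q r)"
  by (simp add: filter_eq_iff eventually_uadd add.assoc)

lemma uadd_mono: "p \<le> p' \<Longrightarrow> q \<le> q' \<Longrightarrow> uadd p q \<le> uadd p' q'"
  by (auto simp: le_filter_def eventually_uadd elim!: eventually_mono)

lemma filtermap_uadd: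
  assumes "\<And>m n. h (m + n) = h m + h n"
  shows "filtermap h (uadd p q) = uadd (filtermap h p) (filtermap h q)"
  by (simp add: filter_eq_iff eventually_uadd eventually_filtermap assms)

lemma ultra_le_iff: "ultra p \<Longrightarrow> ultra q \<Longrightarrow> p \<le> q \<longleftrightarrow> p = q"
  using ultra_le_eq ultra_nonbot by blast

text \<open>Right division: the largest filter \<open>F\<close> with
  \<open>uadd F e \<le> q\<close>, see \<open>le_rquot\<close>. It encodes the closed set of
  ultrafilters whose sum with \<open>e\<close> lies below \<open>q\<close>.\<close>

definition rquot :: "'g::plus filter \<Rightarrow> 'g filter \<Rightarrow> 'g filter" where
  "rquot q e = (INF P\<in>{P. eventually P q}. principal {m. eventually (\<lambda>n. P (m + n)) e})"

lemma le_rquot: "p \<le> rquot q e \<longleftrightarrow> uadd p e \<le> q"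
  unfolding rquot_def le_INF_iff le_principal by (auto simp: le_filter_def eventually_uadd)

lemma eventually_rquot:
  assumes "eventually Q (rquot q e)"
  shows "\<exists>P. eventually P q \<and> (\<forall>m. eventually (\<lambda>n. P (m + n)) e \<longrightarrow> Q m)"
proof -
  have "\<exists>P\<in>{P. eventually P q}. eventually Q (principal {m. eventually (\<lambda>n. P (m + n)) e})"
    using assms unfolding rquot_def
  proof (subst (asm) eventually_INF_base)
    show "{P. eventually P q} \<noteq> {}" by (auto intro!: exI[of _ "\<lambda>_. True"])
    fix P R assume "P \<in> {P. eventually P q}" "R \<in> {P. eventually P q}"
    then show "\<exists>x\<in>{P. eventually P q}. principal {m. \<forall>\<^sub>F n in e. x (m + n)}
        \<le> inf (principal {m. \<forall>\<^sub>F n in e. P (m + n)}) (principal {m. \<forall>\<^sub>F n in e. R (m + n)})"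
      by (intro bexI[of _ "\<lambda>n. P n \<and> R n"]) (auto simp: eventually_conj_iff)
  qed
  then show ?thesis by (auto simp: eventually_principal)
qed

text \<open>Compactness of the set of ultrafilters below \<open>F\<close>: its right translate by \<open>e\<close> is again closed.\<close>

lemma ultra_le_uaddE:
  assumes "ultra q" "ultra e" "q \<le> uadd F e"
  obtains p where "ultra p" "p \<le> F" "q = uadd p e"
proof -
  \<comment> \<open>If the two closed sets were disjoint, some \<open>P\<close> in \<open>q\<close>
    would be avoided by \<open>m + e\<close> for \<open>F\<close>-almost all \<open>m\<close>. Then
    \<open>uadd F e\<close>, and with it \<open>q\<close>, would avoid \<open>P\<close>.\<close>
  have "inf F (rquot q e) \<noteq> bot"
  proof
    assume "inf F (rquot q e) = bot"
    then obtain Q R where QR: "eventually Q F" "eventually R (rquot q e)" "\<And>m. \<not> (Q m \<and> R m)"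
      using eventually_inf[of "\<lambda>_. False" F "rquot q e"] by (auto simp: eventually_False)
    obtain P where P: "eventually P q" "\<And>m. eventually (\<lambda>n. P (m + n)) e \<Longrightarrow> R m"
      using eventually_rquot[OF QR(2)] by auto
    have "eventually (\<lambda>m. eventually (\<lambda>n. \<not> P (m + n)) e) F"
      using QR(1) by (rule eventually_mono) (use QR(3) P(2) assms(2) in \<open>auto simp: ultra_not\<close>)
    then have "eventually (\<lambda>n. \<not> P n) q"
      using assms(3) by (simp add: le_filter_def eventually_uadd)
    with P(1) assms(1) show False by (simp add: ultra_not)
  qed
  then obtain p where p: "ultra p" "p \<le> inf F (rquot q e)" using ex_ultra_le by blast
  then have "uadd p e \<le> q" by (simp add: le_rquot)
  then have "uadd p e = q" using p assms by (simp add: ultra_le_iff ultra_uadd)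
  then show thesis using p that by auto
qed

text \<open>
  The Ellis-Numakura lemma: closed subsets of the space of ultrafilters are represented by the
  filters \<open>F\<close> whose ultrafilters they collect.
\<close>

lemma Ellis_idempotent:
  fixes F :: "'g::semigroup_add filter"
  assumes "F \<noteq> bot"
    and "\<And>p q. ultra p \<Longrightarrow> ultra q \<Longrightarrow> p \<le> F \<Longrightarrow> q \<le> F \<Longrightarrow> uadd p q \<le> F"
  shows "\<exists>e. ultra e \<and> e \<le> F \<and> uadd e e = e"
proof -
  \<comment> \<open>The filters in \<open>A\<close> represent the nonempty closed subsemigroups;
    \<open>m\<close> will be a minimal one and \<open>e\<close> any of its elements.\<close>
  define A where "A = {G :: 'g filter. G \<noteq> bot \<and>
    (\<forall>p q. ultra p \<longrightarrow> ultra q \<longrightarrow> p \<le> G \<longrightarrow> q \<le> G \<longrightarrow> uadd p q \<le> G)}"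
  have "\<exists>m\<in>A. m \<le> F \<and> (\<forall>a\<in>A. a \<le> m \<longrightarrow> a = m)"
  proof (rule filter_Zorn)
    show "F \<in> A" using assms by (auto simp: A_def)
    fix C assume C: "C \<subseteq> A" "C \<noteq> {}" "\<And>a b. a \<in> C \<Longrightarrow> b \<in> C \<Longrightarrow> a \<le> b \<or> b \<le> a"
    then have "Inf C \<noteq> bot" by (intro Inf_chain_nonbot) (auto simp: A_def)
    moreover have "uadd p q \<le> Inf C" if "ultra p" "ultra q" "p \<le> Inf C" "q \<le> Inf C" for p q
      unfolding le_Inf_iff
    proof
      fix G assume "G \<in> C"
      then have "G \<in> A" "p \<le> G" "q \<le> G" using that C(1) by (auto simp: le_Inf_iff)
      then show "uadd p q \<le> G" using that(1,2) by (simp add: A_def)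
    qed
    ultimately show "Inf C \<in> A" by (auto simp: A_def)
  qed
  then obtain m where m: "m \<in> A" "m \<le> F" "\<And>a. a \<in> A \<Longrightarrow> a \<le> m \<Longrightarrow> a = m" by auto
  obtain e where e: "ultra e" "e \<le> m"
    using m(1) ex_ultra_le[of m] by (auto simp: A_def)
  have semi: "uadd p q \<le> m" if "ultra p" "ultra q" "p \<le> m" "q \<le> m" for p q
    using m(1) that by (auto simp: A_def)
  have le: "uadd m e \<le> m"
  proof (rule filter_leI)
    fix P assume "eventually P m"
    show "eventually P (uadd m e)"
      unfolding eventually_uadd[of P m e]
    proof (rule eventually_ultraI)
      fix p assume "ultra p" "p \<le> m"
      then have "uadd p e \<le> m" by (intro semi e)
      from filter_leD[OF this \<open>eventually P m\<close>]
      show "\<forall>\<^sub>F a in p. \<forall>\<^sub>F n in e. P (a + n)" by (simp add: eventually_uadd)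
    qed
  qed
  \<comment> \<open>The translate of the semigroup by \<open>e\<close> is a closed subsemigroup of
    it, hence everything by minimality. So \<open>e\<close> itself has the form
    \<open>uadd p e\<close>.\<close>
  have "uadd m e \<in> A"
    unfolding A_def
  proof (intro CollectI conjI allI impI)
    show "uadd m e \<noteq> bot" using m(1) e by (simp add: A_def uadd_nonbot ultra_nonbot)
    fix p q assume *: "ultra p" "ultra q" "p \<le> uadd m e" "q \<le> uadd m e"
    obtain q' where q': "ultra q'" "q' \<le> m" "q = uadd q' e"
      using ultra_le_uaddE[OF *(2) e(1) *(4)] .
    have "uadd p q' \<le> m" using * q' le by (intro semi) auto
    then show "uadd p q \<le> uadd m e"
      by (simp add: q'(3) uadd_mono flip: uadd_assoc)
  qed
  then have "uadd m e = m" using le m(3) by blast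
  then obtain p where p: "ultra p" "p \<le> m" "e = uadd p e"
    using ultra_le_uaddE[OF e(1) e(1), of m] e(2) by auto
  \<comment> \<open>The elements of \<open>m\<close> that fix \<open>e\<close> from the left form
    another closed subsemigroup, nonempty because of \<open>p\<close>. By minimality it contains
    \<open>e\<close>.\<close>
  have "inf m (rquot e e) \<in> A"
    unfolding A_def
  proof (intro CollectI conjI allI impI)
    have "p \<le> inf m (rquot e e)" using p by (simp add: le_rquot)
    then show "inf m (rquot e e) \<noteq> bot"
      using ultra_nonbot[OF p(1)] le_bot[of p] by fastforce
    fix p q assume *: "ultra p" "ultra q" "p \<le> inf m (rquot e e)" "q \<le> inf m (rquot e e)"
    then have "uadd p e \<le> e" "uadd q e \<le> e" by (simp_all add: le_rquot)
    then have "uadd p (uadd q e) \<le> e"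
      using order_trans[OF uadd_mono[OF order_refl]] by blast
    then show "uadd p q \<le> inf m (rquot e e)"
      using * semi by (simp add: le_rquot uadd_assoc)
  qed
  then have "inf m (rquot e e) = m" by (rule m(3)) simp
  then have "e \<le> rquot e e" using e(2) inf_le2[of m "rquot e e"] by simp
  then have "uadd e e = e" using e(1) by (simp add: le_rquot ultra_le_iff ultra_uadd)
  then show ?thesis using e m(2) order_trans[of e m F] by blast
qed

section \<open>Minimal left ideals\<close>

lemma mli_ultra: "minimal_left_ideal M \<Longrightarrow> p \<in> M \<Longrightarrow> ultra p"
  by (auto simp: minimal_left_ideal_def left_ideal_def betaZ_eq)

lemma mli_left: "minimal_left_ideal M \<Longrightarrow> ultra q \<Longrightarrow> p \<in> M \<Longrightarrow> uadd q p \<in> M"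
  by (auto simp: minimal_left_ideal_def left_ideal_def betaZ_eq bz_add_eq)

text \<open>All sums \<open>uadd r p\<close> form a left ideal inside \<open>M\<close>, which
  minimality forces to be \<open>M\<close>.\<close>

lemma mli_div:
  assumes M: "minimal_left_ideal M" and "p \<in> M" "q \<in> M"
  shows "\<exists>r. ultra r \<and> q = uadd r p"
proof -
  let ?L = "(\<lambda>r. uadd r p) ` Collect ultra"
  have p: "ultra p" using assms mli_ultra by blast
  have "left_ideal ?L"
    unfolding left_ideal_def betaZ_eq bz_add_eq
  proof (intro conjI ballI)
    show "?L \<noteq> {}" using p by auto
    show "?L \<subseteq> Collect ultra" using p by (auto intro: ultra_uadd)
    show "uadd s q \<in> ?L" if "s \<in> Collect ultra" "q \<in> ?L" for s q
      using that by (auto simp flip: uadd_assoc intro!: imageI ultra_uadd)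
  qed
  moreover have "?L \<subseteq> M" using assms by (auto intro: mli_left)
  ultimately have "?L = M" using M by (auto simp: minimal_left_ideal_def)
  then show ?thesis using \<open>q \<in> M\<close> by auto
qed

lemma mli_right_id:
  assumes "minimal_left_ideal M" "e \<in> M" "uadd e e = e" "p \<in> M"
  shows "uadd p e = p"
  using mli_div[OF assms(1,2,4)] assms(3) by (auto simp: uadd_assoc)

text \<open>A left ideal inside the translate pulls back to a left ideal \<open>K\<close> inside
  \<open>M\<close>, and minimality of \<open>M\<close> gives \<open>K = M\<close>.\<close>

lemma mli_translate:
  assumes M: "minimal_left_ideal M" and p: "ultra p"
  shows "minimal_left_ideal ((\<lambda>m. uadd m p) ` M)"
  unfolding minimal_left_ideal_def
proof (intro conjI allI impI)
  have ne: "M \<noteq> {}" using M by (auto simp: minimal_left_ideal_def left_ideal_def)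
  show "left_ideal ((\<lambda>m. uadd m p) ` M)"
    unfolding left_ideal_def betaZ_eq bz_add_eq
  proof (intro conjI ballI)
    show "(\<lambda>m. uadd m p) ` M \<noteq> {}" using ne by simp
    show "(\<lambda>m. uadd m p) ` M \<subseteq> Collect ultra" using p mli_ultra[OF M] by (auto intro: ultra_uadd)
    show "uadd s q \<in> (\<lambda>m. uadd m p) ` M" if "s \<in> Collect ultra" "q \<in> (\<lambda>m. uadd m p) ` M" for s q
      using that mli_left[OF M] by (auto simp flip: uadd_assoc)
  qed
  fix L assume L: "left_ideal L \<and> L \<subseteq> (\<lambda>m. uadd m p) ` M"
  define K where "K = {m \<in> M. uadd m p \<in> L}"
  have "left_ideal K"
    unfolding left_ideal_def betaZ_eq bz_add_eq
  proof (intro conjI ballI)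
    show "K \<noteq> {}" using L by (fastforce simp: K_def left_ideal_def)
    show "K \<subseteq> Collect ultra" using mli_ultra[OF M] by (auto simp: K_def)
    show "uadd s q \<in> K" if "s \<in> Collect ultra" "q \<in> K" for s q
      using that L mli_left[OF M] by (auto simp: K_def left_ideal_def betaZ_eq bz_add_eq uadd_assoc)
  qed
  then have "K = M" using M by (auto simp: minimal_left_ideal_def K_def)
  then show "L = (\<lambda>m. uadd m p) ` M" using L by (auto simp: K_def)
qed

definition min_idem :: "int filter \<Rightarrow> bool" where
  "min_idem w \<longleftrightarrow> (\<exists>M. minimal_left_ideal M \<and> w \<in> M) \<and> uadd w w = w"

lemma min_idem_ultra: "min_idem w \<Longrightarrow> ultra w"
  by (auto simp: min_idem_def intro: mli_ultra)

text \<open>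
  An element \<open>p\<close> with \<open>w + p = p\<close> carries the idempotent \<open>u\<close> of its own ideal to \<open>w\<close>; \<open>r\<close> is
  the inverse passage.
\<close>

lemma min_idem_transport:
  assumes M: "minimal_left_ideal M" and "u \<in> M" "uadd u u = u" "p \<in> M"
    and w: "min_idem w" "uadd w p = p"
  shows "\<exists>r. ultra r \<and> uadd r p = u \<and> uadd p r = w"
proof -
  obtain N where N: "minimal_left_ideal N" "w \<in> N" and ww: "uadd w w = w"
    using w by (auto simp: min_idem_def)
  obtain s where s: "ultra s" "u = uadd s p" using mli_div[OF M \<open>p \<in> M\<close> \<open>u \<in> M\<close>] by auto
  \<comment> \<open>The factor \<open>w\<close> on the right moves \<open>s\<close> into the ideal
    \<open>N\<close> of \<open>w\<close>, so \<open>uadd p r\<close> becomes an idempotent of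
    \<open>N\<close>.\<close>
  define r where "r = uadd s w"
  have r: "r \<in> N" using s N by (auto simp: r_def intro: mli_left)
  have rp: "uadd r p = u" using s w by (simp add: r_def uadd_assoc)
  have pu: "uadd p u = p" using mli_right_id assms by blast
  have e: "uadd p r \<in> N" using r mli_left[OF N(1)] mli_ultra[OF M \<open>p \<in> M\<close>] by blast
  have ee: "uadd (uadd p r) (uadd p r) = uadd p r"
    by (metis rp pu uadd_assoc)
  \<comment> \<open>The sum is evaluated twice: \<open>w\<close> absorbs into \<open>p\<close> from
    the left, and the idempotent \<open>uadd p r\<close> is a right identity on
    \<open>N\<close>.\<close>
  have "uadd w (uadd p r) = uadd p r" using w by (simp flip: uadd_assoc)
  moreover have "uadd w (uadd p r) = w" using mli_right_id[OF N(1) e ee N(2)] .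
  ultimately show ?thesis using rp r mli_ultra[OF N(1)] by auto
qed

section \<open>The action of ultrafilters\<close>

lemma ultra_compact_lim:
  fixes f :: "'i \<Rightarrow> 'a::topological_space"
  assumes "ultra p" "compact K" "eventually (\<lambda>i. f i \<in> K) p"
  shows "\<exists>l\<in>K. (f \<longlongrightarrow> l) p"
proof -
  have u: "ultra (filtermap f p)" using assms(1) by (rule ultra_filtermap)
  have "eventually (\<lambda>x. x \<in> K) (filtermap f p)" using assms(3) by (simp add: eventually_filtermap)
  then obtain l where l: "l \<in> K" "inf (nhds l) (filtermap f p) \<noteq> bot"
    using assms(2) u unfolding compact_filter by (metis ultra_nonbot)
  then have "inf (nhds l) (filtermap f p) = filtermap f p" using ultra_le_eq[OF u] by simp
  then have "filtermap f p \<le> nhds l" by (metis inf_le1)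
  then show ?thesis using l(1) by (auto simp: filterlim_def)
qed

text \<open>The limit of the sets T^k B along \<open>p\<close>, stated with neighbourhoods instead
  of a metric. For an ultrafilter and nonempty \<open>B\<close> it is the circle operation, see
  \<open>circ_eq\<close>.\<close>

definition lsup :: "('a::topological_space \<Rightarrow> 'a) \<Rightarrow> int filter \<Rightarrow> 'a set \<Rightarrow> 'a set" where
  "lsup T p B = {x. \<forall>Q. open Q \<longrightarrow> x \<in> Q \<longrightarrow> (\<forall>\<^sub>F k in p. iter T k ` B \<inter> Q \<noteq> {})}"

lemma lsupD: "x \<in> lsup T p B \<Longrightarrow> open Q \<Longrightarrow> x \<in> Q \<Longrightarrow> \<forall>\<^sub>F k in p. iter T k ` B \<inter> Q \<noteq> {}"
  by (auto simp: lsup_def)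

lemma lsup_mono: "B \<subseteq> C \<Longrightarrow> lsup T p B \<subseteq> lsup T p C"
  unfolding lsup_def by (fastforce elim!: eventually_mono)

text \<open>Otherwise each piece has a neighbourhood of \<open>x\<close> that it fails to meet along
  \<open>p\<close>. The intersection of these is met by the union, and the ultrafilter singles out
  one piece, a contradiction.\<close>

lemma lsup_UN_finite:
  assumes "ultra p" "finite I" "x \<in> lsup T p (\<Union>i\<in>I. B i)"
  shows "\<exists>i\<in>I. x \<in> lsup T p (B i)"
proof (rule ccontr)
  assume "\<not> ?thesis"
  then have "\<forall>i\<in>I. \<exists>Q. open Q \<and> x \<in> Q \<and> \<not> (\<forall>\<^sub>F k in p. iter T k ` B i \<inter> Q \<noteq> {})"
    by (auto simp: lsup_def)
  then obtain Q where Q: "\<And>i. i \<in> I \<Longrightarrow> open (Q i) \<and> x \<in> Q i \<and> \<not> (\<forall>\<^sub>F k in p. iter T k ` B i \<inter> Q i \<noteq> {})"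
    by metis
  have "open (\<Inter>i\<in>I. Q i)" "x \<in> (\<Inter>i\<in>I. Q i)" using Q assms(2) by auto
  from lsupD[OF assms(3) this]
  have "\<forall>\<^sub>F k in p. \<exists>i\<in>I. iter T k ` B i \<inter> Q i \<noteq> {}"
    by (rule eventually_mono) blast
  from ultra_Bex_finite[OF assms(1,2) this] Q show False by auto
qed

text \<open>This turns the setwise limit into convergence of points: an ultrafilter on pairs (k, b)
  plays the role of a net T^k b with b in \<open>B\<close>.\<close>

lemma lsup_ultra:
  assumes p: "ultra p" and x: "x \<in> lsup T p B"
  obtains G where "ultra G" "filtermap fst G = p" "\<forall>\<^sub>F g in G. snd g \<in> B"
    "((\<lambda>g. iter T (fst g) (snd g)) \<longlongrightarrow> x) G"
proof -
  \<comment> \<open>The three filters impose first coordinate along \<open>p\<close>, second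
    coordinate in \<open>B\<close>, and convergence to \<open>x\<close>. Membership of
    \<open>x\<close> in \<open>lsup\<close> makes them compatible.\<close>
  define G where "G = inf (filtercomap fst p) (inf (principal (UNIV \<times> B))
    (filtercomap (\<lambda>g. iter T (fst g) (snd g)) (nhds x)))"
  have "G \<noteq> bot"
  proof
    assume "G = bot"
    then have "eventually (\<lambda>_. False) G" by simp
    then obtain P1 P2 where P: "eventually P1 (filtercomap fst p)"
      "eventually P2 (inf (principal (UNIV \<times> B)) (filtercomap (\<lambda>g. iter T (fst g) (snd g)) (nhds x)))"
      "\<And>g. \<not> (P1 g \<and> P2 g)"
      unfolding G_def eventually_inf by auto
    obtain P3 P4 where P': "eventually P3 (principal (UNIV \<times> B))"
      "eventually P4 (filtercomap (\<lambda>g. iter T (fst g) (snd g)) (nhds x))"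
      "\<And>g. P3 g \<Longrightarrow> P4 g \<Longrightarrow> P2 g"
      using P(2) unfolding eventually_inf by auto
    obtain P5 where P5: "eventually P5 p" "\<And>g. P5 (fst g) \<Longrightarrow> P1 g"
      using P(1) by (auto simp: eventually_filtercomap)
    obtain Q where Q: "open Q" "x \<in> Q" "\<And>g. iter T (fst g) (snd g) \<in> Q \<Longrightarrow> P4 g"
      using P'(2) unfolding eventually_filtercomap eventually_nhds by blast
    have "\<forall>\<^sub>F k in p. False"
      using lsupD[OF x Q(1,2)] P5(1)
    proof eventually_elim
      case (elim k)
      then obtain b where b: "b \<in> B" "iter T k b \<in> Q" by auto
      then have "P3 (k, b)" using P'(1) by (auto simp: eventually_principal)
      moreover have "P4 (k, b)" using Q(3)[of "(k, b)"] b by simp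
      ultimately show False using P(3)[of "(k, b)"] P'(3)[of "(k, b)"] P5(2)[of "(k, b)"] elim by simp
    qed
    then show False using p by (simp add: ultra_def)
  qed
  then obtain H where H: "ultra H" "H \<le> G" using ex_ultra_le by blast
  have "H \<le> filtercomap fst p" "H \<le> principal (UNIV \<times> B)"
    "H \<le> filtercomap (\<lambda>g. iter T (fst g) (snd g)) (nhds x)"
    using H(2) by (auto simp: G_def)
  then have "filtermap fst H \<le> p" "\<forall>\<^sub>F g in H. snd g \<in> B"
    "((\<lambda>g. iter T (fst g) (snd g)) \<longlongrightarrow> x) H"
    by (auto simp: filtermap_le_iff_le_filtercomap filterlim_def le_principal elim!: eventually_mono)
  moreover have "filtermap fst H = p"
    using calculation(1) ultra_filtermap[OF H(1), of fst] p by (simp add: ultra_le_iff)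
  ultimately show thesis using that H(1) by blast
qed

lemma act_eqI:
  fixes T :: "'a::metric_space \<Rightarrow> 'a"
  shows "ultra p \<Longrightarrow> ((\<lambda>m. iter T m x) \<longlongrightarrow> y) p \<Longrightarrow> bz_act T p x = y"
  unfolding bz_act_def using ultra_nonbot by (intro tendsto_Lim) auto

locale csystem =
  fixes T :: "'a::metric_space \<Rightarrow> 'a"
  assumes tds: "tds T"
begin

abbreviation act :: "int filter \<Rightarrow> 'a \<Rightarrow> 'a" where "act \<equiv> bz_act T"

lemma compact_UNIV: "compact (UNIV :: 'a set)"
  using tds by (simp add: tds_def)

lemma bij: "bij T" and cont: "continuous_on UNIV T" and cont_inv: "continuous_on UNIV (inv T)"
proof -
  obtain T' where T': "homeomorphism UNIV UNIV T T'" using tds by (auto simp: tds_def)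
  then have "\<And>x. T' (T x) = x" "\<And>x. T (T' x) = x" by (auto simp: homeomorphism_def)
  then have "T \<circ> T' = id" "T' \<circ> T = id" by (simp_all add: fun_eq_iff)
  then have "inv T = T'" "bij T" by (simp_all add: inv_unique_comp o_bij)
  then show "bij T" "continuous_on UNIV T" "continuous_on UNIV (inv T)"
    using T' by (auto simp: homeomorphism_def)
qed

lemma iter_0 [simp]: "iter T 0 x = x"
  by (simp add: iter_def)

lemma iter_Suc: "iter T (n + 1) x = T (iter T n x)"
proof (cases "0 \<le> n")
  case True
  then show ?thesis by (simp add: iter_def nat_add_distrib)
next
  case False
  then have "nat (- n) = Suc (nat (- (n + 1)))" by simp
  then show ?thesis using False bij
    by (auto simp: iter_def bij_is_surj surj_f_inv_f)
qed

lemma iter_pred: "iter T (n - 1) x = inv T (iter T n x)"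
  using iter_Suc[of "n - 1" x] bij by (simp add: bij_is_inj inv_f_f)

lemma iter_add: "iter T (m + n) x = iter T m (iter T n x)"
proof (induction m rule: int_induct[where k = 0])
  case (step1 i)
  then show ?case using iter_Suc[of "i + n"] iter_Suc[of i] by (simp add: algebra_simps)
next
  case (step2 i)
  then show ?case using iter_pred[of "i + n"] iter_pred[of i] by (simp add: algebra_simps)
qed simp

lemma iter_minus [simp]: "iter T (- n) (iter T n x) = x" "iter T n (iter T (- n) x) = x"
  by (simp_all flip: iter_add)

lemma cont_iter: "continuous_on UNIV (iter T n)"
proof (induction n rule: int_induct[where k = 0])
  case base
  then show ?case by simp
next
  case (step1 i)
  have "iter T (i + 1) = T \<circ> iter T i" by (simp add: fun_eq_iff iter_Suc)
  moreover have "continuous_on (range (iter T i)) T" using cont continuous_on_subset by blast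
  ultimately show ?case using step1 by (simp only: continuous_on_compose)
next
  case (step2 i)
  have "iter T (i - 1) = inv T \<circ> iter T i" by (simp add: fun_eq_iff iter_pred)
  moreover have "continuous_on (range (iter T i)) (inv T)" using cont_inv continuous_on_subset by blast
  ultimately show ?case using step2 by (simp only: continuous_on_compose)
qed

lemma tendsto_iter: "(f \<longlongrightarrow> l) F \<Longrightarrow> ((\<lambda>i. iter T n (f i)) \<longlongrightarrow> iter T n l) F"
  using cont_iter by (metis UNIV_I continuous_on_eq_continuous_at isCont_tendsto_compose open_UNIV)

lemma open_vimage_iter: "open Q \<Longrightarrow> open (iter T n -` Q)"
  using cont_iter open_vimage by blast

lemma act_lim: "ultra p \<Longrightarrow> ((\<lambda>m. iter T m x) \<longlongrightarrow> act p x) p"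
  using ultra_compact_lim[OF _ compact_UNIV, of p "\<lambda>m. iter T m x"] act_eqI[of p T x] by auto

lemma act_uadd:
  assumes "ultra p" "ultra q"
  shows "act (uadd p q) x = act p (act q x)"
proof (rule act_eqI)
  show "ultra (uadd p q)" using assms by (rule ultra_uadd)
  show "((\<lambda>m. iter T m x) \<longlongrightarrow> act p (act q x)) (uadd p q)"
  proof (rule topological_tendstoI)
    fix Q assume Q: "open Q" "act p (act q x) \<in> Q"
    have "\<forall>\<^sub>F m in p. iter T m (act q x) \<in> Q"
      using topological_tendstoD[OF act_lim[OF assms(1)] Q] .
    then show "\<forall>\<^sub>F m in uadd p q. iter T m x \<in> Q"
      unfolding eventually_uadd
    proof eventually_elim
      case (elim m)
      then show ?case
        using topological_tendstoD[OF tendsto_iter[OF act_lim[OF assms(2)]] Q(1), of m x]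
        by (simp add: iter_add)
    qed
  qed
qed

lemma act_in_lsup:
  assumes "ultra p" "b \<in> B"
  shows "act p b \<in> lsup T p B"
  unfolding lsup_def
proof (intro CollectI allI impI)
  fix Q assume "open Q" "act p b \<in> Q"
  from topological_tendstoD[OF act_lim[OF assms(1)] this]
  show "\<forall>\<^sub>F k in p. iter T k ` B \<inter> Q \<noteq> {}"
    by (rule eventually_mono) (use assms in auto)
qed

text \<open>One inclusion of the law p o (q o B) = (p + q) o B: neighbourhoods are pulled back along
  the homeomorphism T^m.\<close>

lemma lsup_lsup: "lsup T p (lsup T q B) \<subseteq> lsup T (uadd p q) B"
proof
  fix x assume x: "x \<in> lsup T p (lsup T q B)"
  show "x \<in> lsup T (uadd p q) B"
    unfolding lsup_def eventually_uadd
  proof (intro CollectI allI impI)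
    fix Q assume Q: "open Q" "x \<in> Q"
    show "\<forall>\<^sub>F m in p. \<forall>\<^sub>F n in q. iter T (m + n) ` B \<inter> Q \<noteq> {}"
      using lsupD[OF x Q]
    proof eventually_elim
      case (elim m)
      then obtain z where z: "z \<in> lsup T q B" "iter T m z \<in> Q" by auto
      have "\<forall>\<^sub>F n in q. iter T n ` B \<inter> iter T m -` Q \<noteq> {}"
        using z Q by (intro lsupD[OF z(1)] open_vimage_iter) auto
      then show ?case by eventually_elim (auto simp: iter_add)
    qed
  qed
qed

lemma lsup_act_image: "ultra r \<Longrightarrow> lsup T p (act r ` B) \<subseteq> lsup T (uadd p r) B"
  using lsup_lsup lsup_mono[of "act r ` B" "lsup T r B" T p] act_in_lsup by blast

lemma act_lsup: "ultra p \<Longrightarrow> x \<in> lsup T q B \<Longrightarrow> act p x \<in> lsup T (uadd p q) B"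
  using lsup_lsup act_in_lsup by blast

end

section \<open>The circle operation\<close>

context csystem
begin

lemma closed_lsup: "closed (lsup T p A)"
proof -
  have "\<exists>Q. open Q \<and> x \<in> Q \<and> Q \<subseteq> - lsup T p A" if "x \<notin> lsup T p A" for x
    using that by (fastforce simp: lsup_def)
  then show ?thesis
    unfolding closed_def by (subst open_subopen) auto
qed

lemma infdist_bdd:
  fixes A B :: "'a set"
  assumes "B \<noteq> {}"
  shows "bdd_above ((\<lambda>a. infdist a B) ` A)"
proof -
  obtain b where b: "b \<in> B" using assms by blast
  have "bounded (UNIV :: 'a set)" using compact_UNIV by (rule compact_imp_bounded)
  then obtain D where D: "\<And>x. dist x b \<le> D"
    using bounded_any_center[of UNIV b] by (auto simp: dist_commute)
  show ?thesis
    using order_trans[OF infdist_le[OF b] D] by (intro bdd_aboveI2[of _ _ D])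
qed

lemma infdist_le_hausdorff:
  fixes A B :: "'a set"
  assumes "A \<noteq> {}" "B \<noteq> {}"
  shows "a \<in> A \<Longrightarrow> infdist a B \<le> hausdorff_dist A B"
    and "b \<in> B \<Longrightarrow> infdist b A \<le> hausdorff_dist A B"
  unfolding hausdorff_dist_def
  using cSUP_upper[OF _ infdist_bdd[OF assms(2)], of a A] cSUP_upper[OF _ infdist_bdd[OF assms(1)], of b B]
  by (auto simp: le_max_iff_disj)

lemma hausdorff_nonneg:
  fixes A B :: "'a set"
  assumes "A \<noteq> {}" "B \<noteq> {}"
  shows "0 \<le> hausdorff_dist A B"
proof -
  obtain a where "a \<in> A" using assms by blast
  then show ?thesis using order_trans[OF infdist_nonneg infdist_le_hausdorff(1)[OF assms]] by blast
qed

lemma iter_image_closure_meets: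
  assumes "open Q" "iter T m ` closure A \<inter> Q \<noteq> {}"
  shows "iter T m ` A \<inter> Q \<noteq> {}"
proof -
  have "closure A \<inter> iter T m -` Q \<noteq> {}" using assms by auto
  then have "A \<inter> iter T m -` Q \<noteq> {}"
    using open_Int_closure_eq_empty[OF open_vimage_iter[OF assms(1)], of m A] by (auto simp: Int_commute)
  then show ?thesis by auto
qed

lemma hausdorff_lim_lsup:
  assumes p: "ultra p" and A: "A \<noteq> {}"
  shows "((\<lambda>m. hausdorff_dist (iter T m ` closure A) (lsup T p A)) \<longlongrightarrow> 0) p"
proof (rule tendstoI)
  fix e :: real assume "0 < e"
  define C where "C = lsup T p A"
  obtain a0 where a0: "a0 \<in> A" using A by auto
  have C: "C \<noteq> {}" using act_in_lsup[OF p a0] by (auto simp: C_def)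
  have K: "iter T m ` closure A \<noteq> {}" for m using A by simp
  \<comment> \<open>A finite e/4-net of the compact limit set reduces this half to finitely many
    neighbourhoods. The bound e/2 leaves room for the final strict inequality.\<close>
  have 1: "\<forall>\<^sub>F m in p. \<forall>c\<in>C. infdist c (iter T m ` closure A) \<le> e / 2"
  proof -
    have "compact C" using compact_Int_closed[OF compact_UNIV closed_lsup] by (simp add: C_def)
    then obtain I where I: "finite I" "I \<subseteq> C" "C \<subseteq> (\<Union>c\<in>I. ball c (e / 4))"
    proof (rule compactE_image[of C C "\<lambda>c. ball c (e / 4)"])
      show "C \<subseteq> (\<Union>c\<in>C. ball c (e / 4))" using \<open>0 < e\<close> by auto
    qed auto
    have "\<forall>\<^sub>F m in p. \<forall>c\<in>I. iter T m ` A \<inter> ball c (e / 4) \<noteq> {}"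
    proof (intro eventually_ball_finite[OF I(1)] ballI)
      fix c assume "c \<in> I"
      then show "\<forall>\<^sub>F m in p. iter T m ` A \<inter> ball c (e / 4) \<noteq> {}"
        using I(2) \<open>0 < e\<close> by (intro lsupD[of c]) (auto simp: C_def)
    qed
    then show ?thesis
    proof (rule eventually_mono, intro ballI)
      fix m c assume m: "\<forall>c\<in>I. iter T m ` A \<inter> ball c (e / 4) \<noteq> {}" and "c \<in> C"
      then obtain i where i: "i \<in> I" "dist i c < e / 4" using I(3) by auto
      then obtain a where a: "a \<in> A" "dist i (iter T m a) < e / 4" using m by fastforce
      have "infdist c (iter T m ` closure A) \<le> dist c (iter T m a)"
        using a(1) closure_subset by (intro infdist_le) blast
      also have "\<dots> \<le> dist i c + dist i (iter T m a)"
        by (metis dist_commute dist_triangle)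
      finally show "infdist c (iter T m ` closure A) \<le> e / 2" using i a by simp
    qed
  qed
  \<comment> \<open>For the other half, points staying e/2 away from \<open>C\<close> would converge
    along \<open>p\<close>; their limit belongs to \<open>C\<close> by definition of
    \<open>lsup\<close>, yet stays at distance e/2.\<close>
  have 2: "\<forall>\<^sub>F m in p. \<forall>a\<in>iter T m ` closure A. infdist a C \<le> e / 2"
  proof (rule ccontr)
    assume "\<not> ?thesis"
    then have "\<forall>\<^sub>F m in p. \<not> (\<forall>a\<in>iter T m ` closure A. infdist a C \<le> e / 2)"
      using ultra_not[OF p] by blast
    then have ev: "\<forall>\<^sub>F m in p. \<exists>a. a \<in> iter T m ` closure A \<and> infdist a C > e / 2"
      by (rule eventually_mono) (auto simp: not_le)
    define a where "a = (\<lambda>m. SOME a. a \<in> iter T m ` closure A \<and> infdist a C > e / 2)"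
    have a: "\<forall>\<^sub>F m in p. a m \<in> iter T m ` closure A \<and> infdist (a m) C > e / 2"
      using ev unfolding a_def by (rule eventually_mono) (rule someI_ex)
    obtain l where l: "(a \<longlongrightarrow> l) p" using ultra_compact_lim[OF p compact_UNIV, of a] by auto
    have "l \<in> C"
      unfolding C_def lsup_def
    proof (intro CollectI allI impI)
      fix Q assume Q: "open Q" "l \<in> Q"
      show "\<forall>\<^sub>F m in p. iter T m ` A \<inter> Q \<noteq> {}"
        using topological_tendstoD[OF l Q] a
        by eventually_elim (rule iter_image_closure_meets[OF Q(1)], blast)
    qed
    moreover have "e / 2 \<le> infdist l C"
    proof (rule tendsto_lowerbound[OF tendsto_infdist[OF l] _ ultra_nonbot[OF p]])
      show "\<forall>\<^sub>F m in p. e / 2 \<le> infdist (a m) C"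
        using a by (rule eventually_mono) simp
    qed
    ultimately show False using \<open>0 < e\<close> by simp
  qed
  show "\<forall>\<^sub>F m in p. dist (hausdorff_dist (iter T m ` closure A) (lsup T p A)) 0 < e"
    using 1 2
  proof eventually_elim
    case (elim m)
    have "hausdorff_dist (iter T m ` closure A) C \<le> e / 2"
      unfolding hausdorff_dist_def max.bounded_iff using K C elim
      by (intro conjI cSUP_least) auto
    then show ?case
      using \<open>0 < e\<close> hausdorff_nonneg[OF K C] by (simp add: C_def)
  qed
qed

lemma hausdorff_lim_unique:
  assumes p: "ultra p" and A: "A \<noteq> {}"
    and C: "closed C" "C \<noteq> {}" "((\<lambda>m. hausdorff_dist (iter T m ` closure A) C) \<longlongrightarrow> 0) p"
  shows "C = lsup T p A"
proof
  have K: "iter T m ` closure A \<noteq> {}" for m using A by simp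
  have small: "\<forall>\<^sub>F m in p. hausdorff_dist (iter T m ` closure A) C < e" if "0 < e" for e
    using C(3) that by (simp add: order_tendsto_iff)
  show "C \<subseteq> lsup T p A"
  proof
    fix c assume c: "c \<in> C"
    show "c \<in> lsup T p A"
      unfolding lsup_def
    proof (intro CollectI allI impI)
      fix Q assume Q: "open Q" "c \<in> Q"
      then obtain e where e: "0 < e" "ball c e \<subseteq> Q" using open_contains_ball by blast
      show "\<forall>\<^sub>F m in p. iter T m ` A \<inter> Q \<noteq> {}"
        using small[OF e(1)]
      proof eventually_elim
        case (elim m)
        then have "infdist c (iter T m ` closure A) < e"
          using infdist_le_hausdorff(2)[OF K C(2) c, of m] by simp
        then obtain a where "a \<in> iter T m ` closure A" "dist c a < e"
          unfolding infdist_notempty[OF K] by (subst (asm) cINF_less_iff) (auto simp: A)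
        then have "iter T m ` closure A \<inter> Q \<noteq> {}" using e(2) mem_ball[of a c e] by blast
        then show ?case by (rule iter_image_closure_meets[OF Q(1)])
      qed
    qed
  qed
  show "lsup T p A \<subseteq> C"
  proof
    fix c assume c: "c \<in> lsup T p A"
    have "infdist c C \<le> 0 + e" if "0 < e" for e
    proof -
      have "\<forall>\<^sub>F m in p. iter T m ` A \<inter> ball c (e / 2) \<noteq> {}"
        using that by (intro lsupD[OF c]) auto
      then have "\<forall>\<^sub>F m in p. iter T m ` A \<inter> ball c (e / 2) \<noteq> {} \<and>
          hausdorff_dist (iter T m ` closure A) C < e / 2"
        using small[of "e / 2"] that by (simp add: eventually_conj_iff)
      then obtain m where m: "iter T m ` A \<inter> ball c (e / 2) \<noteq> {}"
        "hausdorff_dist (iter T m ` closure A) C < e / 2"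
        using eventually_happens'[OF ultra_nonbot[OF p]] by blast
      then obtain a where a: "a \<in> A" "dist c (iter T m a) < e / 2" by auto
      then have "infdist (iter T m a) C < e / 2"
        using infdist_le_hausdorff(1)[OF K C(2), of "iter T m a" m] m(2) closure_subset by force
      then show ?thesis using infdist_triangle[of c C "iter T m a"] a(2) by simp
    qed
    then have "infdist c C \<le> 0" by (rule field_le_epsilon)
    then show "c \<in> C"
      using in_closed_iff_infdist_zero[OF C(1,2)] infdist_nonneg[of c C] by simp
  qed
qed

text \<open>Existence and uniqueness of the Hausdorff limit make the definite description in
  \<open>circ\<close> meaningful; afterwards the metric is no longer mentioned in RIC
  arguments.\<close>

lemma circ_eq:
  assumes p: "ultra p" and A: "A \<noteq> {}"
  shows "circ T p A = lsup T p A"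
  unfolding circ_def
proof (rule the_equality)
  obtain a where a: "a \<in> A" using A by auto
  show "closed (lsup T p A) \<and> lsup T p A \<noteq> {} \<and>
      ((\<lambda>m. hausdorff_dist (iter T m ` closure A) (lsup T p A)) \<longlongrightarrow> 0) p"
    using closed_lsup act_in_lsup[OF p a] hausdorff_lim_lsup[OF p A] by blast
qed (use hausdorff_lim_unique[OF p A] in blast)

end

section \<open>Consequences of the RIC property\<close>

lemma ex_ultra_lim:
  assumes "\<And>Q. open Q \<Longrightarrow> y \<in> Q \<Longrightarrow> \<exists>i. f i \<in> Q"
  shows "\<exists>p. ultra p \<and> (f \<longlongrightarrow> y) p"
proof -
  have "filtercomap f (nhds y) \<noteq> bot"
  proof (rule filtercomap_neq_bot)
    fix P assume "eventually P (nhds y)"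
    then obtain Q where "open Q" "y \<in> Q" "\<And>x. x \<in> Q \<Longrightarrow> P x" unfolding eventually_nhds by blast
    then show "\<exists>i. P (f i)" using assms[of Q] by blast
  qed
  then show ?thesis
    using ex_ultra_le unfolding filterlim_def filtermap_le_iff_le_filtercomap by blast
qed

locale ric_ext = X: csystem T + Y: csystem S
  for T :: "'a::metric_space \<Rightarrow> 'a" and S :: "'b::metric_space \<Rightarrow> 'b" +
  fixes \<pi> :: "'a \<Rightarrow> 'b"
  assumes minT: "closure (range (\<lambda>n. iter T n x)) = UNIV"
    and minS: "closure (range (\<lambda>n. iter S n y)) = UNIV"
    and ext: "extension T S \<pi>"
    and ric: "RIC_extension T S \<pi>"
begin

lemma cont_pi: "continuous_on UNIV \<pi>" and surj_pi: "surj \<pi>" and pi_T: "\<pi> (T x) = S (\<pi> x)"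
  using ext unfolding extension_def by (blast, blast, metis comp_apply)

lemma pi_iter: "\<pi> (iter T n x) = iter S n (\<pi> x)"
proof (induction n rule: int_induct[where k = 0])
  case (step1 i)
  then show ?case by (simp add: X.iter_Suc Y.iter_Suc pi_T)
next
  case (step2 i)
  have "S (\<pi> (iter T (i - 1) x)) = \<pi> (iter T i x)"
    using X.iter_Suc[of "i - 1" x] by (simp flip: pi_T)
  also have "\<dots> = S (iter S (i - 1) (\<pi> x))"
    using step2 Y.iter_Suc[of "i - 1" "\<pi> x"] by simp
  finally show ?case using Y.bij by (simp add: bij_is_inj inj_eq)
qed simp

lemma tendsto_pi: "(f \<longlongrightarrow> l) F \<Longrightarrow> ((\<lambda>i. \<pi> (f i)) \<longlongrightarrow> \<pi> l) F"
  using cont_pi by (metis UNIV_I continuous_on_eq_continuous_at isCont_tendsto_compose open_UNIV)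

lemma open_vimage_pi: "open V \<Longrightarrow> open (\<pi> -` V)"
  using cont_pi open_vimage by blast

lemma pi_act: "ultra p \<Longrightarrow> \<pi> (X.act p x) = Y.act p (\<pi> x)"
  using tendsto_pi[OF X.act_lim[of p x]] by (simp add: pi_iter act_eqI)

lemma reachT: "\<exists>p. ultra p \<and> X.act p x = z"
proof -
  have "\<exists>i. iter T i x \<in> Q" if "open Q" "z \<in> Q" for Q
    using open_Int_closure_eq_empty[OF that(1), of "range (\<lambda>n. iter T n x)"] minT[of x] that by auto
  then show ?thesis using ex_ultra_lim[of z "\<lambda>i. iter T i x"] act_eqI[of _ T x z] by blast
qed

lemma reachS: "\<exists>p. ultra p \<and> Y.act p y = z"
proof -
  obtain x x' where "\<pi> x = y" "\<pi> x' = z" using surj_pi by (metis surjD)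
  moreover obtain p where "ultra p" "X.act p x = x'" using reachT by blast
  ultimately show ?thesis using pi_act by metis
qed

text \<open>If \<open>w\<close> is an idempotent ultrafilter fixing \<open>y\<close>, this is the
  image under \<open>w\<close> of the fibre over \<open>y\<close>.\<close>

definition fixpts :: "int filter \<Rightarrow> 'b \<Rightarrow> 'a set" where
  "fixpts w y = {a. X.act w a = a \<and> \<pi> a = y}"

lemma ric_data:
  obtains M u y0 where "minimal_left_ideal M" "u \<in> M" "uadd u u = u" "Y.act u y0 = y0"
    "\<And>p x. p \<in> M \<Longrightarrow> \<pi> x = Y.act p y0 \<Longrightarrow> x \<in> lsup T p (X.act u ` (\<pi> -` {y0}))"
proof -
  obtain M u y0 where *: "minimal_left_ideal M" "u \<in> M" "bz_add u u = u" "bz_act S u y0 = y0"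
    "\<And>p. p \<in> M \<Longrightarrow> \<pi> -` {bz_act S p y0} = circ T p (bz_act T u ` (\<pi> -` {y0}))"
    using ric unfolding RIC_extension_def by blast
  have "\<pi> -` {y0} \<noteq> {}" using surj_pi by (metis surj_def vimage_singleton_eq empty_iff)
  then have "x \<in> lsup T p (X.act u ` (\<pi> -` {y0}))" if "p \<in> M" "\<pi> x = Y.act p y0" for p x
    using *(5)[OF that(1)] that(2) mli_ultra[OF *(1) that(1)] by (auto simp: X.circ_eq)
  then show thesis using that * by (simp add: bz_add_eq)
qed

lemma ex_min_idem: "\<exists>w. min_idem w"
proof -
  obtain M u y0 where "minimal_left_ideal M" "u \<in> M" "uadd u u = u" using ric_data by metis
  then show ?thesis by (auto simp: min_idem_def)
qed

text \<open>\<open>RIC_extension\<close> speaks of one ideal, one idempotent and one base point.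
  Here it is carried over to any minimal idempotent \<open>w\<close> and any point fixed by it, by
  means of \<open>min_idem_transport\<close>.\<close>

lemma fiber_lsup:
  assumes w: "min_idem w" and y: "Y.act w y = y" and x: "\<pi> x = y"
  shows "x \<in> lsup T w (fixpts w y)"
proof -
  obtain M u y0 where M: "minimal_left_ideal M" and u: "u \<in> M" "uadd u u = u" "Y.act u y0 = y0"
    and R: "\<And>p x. p \<in> M \<Longrightarrow> \<pi> x = Y.act p y0 \<Longrightarrow> x \<in> lsup T p (X.act u ` (\<pi> -` {y0}))"
    using ric_data by blast
  note uu = mli_ultra[OF M u(1)] and wu = min_idem_ultra[OF w]
  have ww: "uadd w w = w" using w by (simp add: min_idem_def)
  obtain r where r: "ultra r" "Y.act r y0 = y" using reachS by blast
  \<comment> \<open>Here \<open>r\<close> carries \<open>y0\<close> to \<open>y\<close>. The summand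
    \<open>u\<close> puts \<open>p\<close> into \<open>M\<close> and \<open>w\<close> gives
    \<open>uadd w p = p\<close>; as \<open>u\<close> fixes \<open>y0\<close> and \<open>w\<close>
    fixes \<open>y\<close>, still \<open>p\<close> sends \<open>y0\<close> to
    \<open>y\<close>.\<close>
  define p where "p = uadd w (uadd r u)"
  have p: "p \<in> M" "ultra p" "uadd w p = p"
    using mli_left[OF M wu mli_left[OF M r(1) u(1)]] r(1) wu uu
    by (auto simp: p_def ww ultra_uadd simp flip: uadd_assoc)
  have py: "Y.act p y0 = y" using r wu uu u(3) y by (simp add: p_def Y.act_uadd ultra_uadd)
  obtain s where s: "ultra s" "uadd s p = u" "uadd p s = w"
    using min_idem_transport[OF M u(1,2) p(1) w p(3)] by blast
  let ?A = "X.act u ` (\<pi> -` {y0})"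
  \<comment> \<open>A \<open>u\<close>-fixed point \<open>a\<close> over \<open>y0\<close> is
    recovered by \<open>s\<close> from its image under \<open>p\<close>, which is
    \<open>w\<close>-fixed over \<open>y\<close>.\<close>
  have "?A \<subseteq> X.act s ` fixpts w y"
  proof
    fix a assume "a \<in> ?A"
    then obtain b where b: "a = X.act u b" "\<pi> b = y0" by auto
    have "X.act u a = a" using b uu u(2) by (metis X.act_uadd)
    then have "a = X.act s (X.act p a)" using s p by (simp flip: X.act_uadd)
    moreover have "X.act w (X.act p a) = X.act p a"
      using p wu by (simp flip: X.act_uadd)
    moreover have "\<pi> (X.act p a) = y"
      using p(2) uu b u(3) py by (simp add: pi_act)
    then have "X.act p a \<in> fixpts w y" using calculation(2) by (simp add: fixpts_def)
    ultimately show "a \<in> X.act s ` fixpts w y" by blast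
  qed
  then have "lsup T p ?A \<subseteq> lsup T p (X.act s ` fixpts w y)" by (rule lsup_mono)
  also have "\<dots> \<subseteq> lsup T w (fixpts w y)" using X.lsup_act_image[OF s(1), of p] s(3) by simp
  finally show ?thesis using R[OF p(1)] x py by auto
qed

text \<open>Suppose points \<open>z\<close> outside the image of \<open>Q\<close> converge to \<pi>
  x. Writing each as \<open>q z\<close> applied to \<open>y0\<close> and passing to the limit
  \<open>t\<close> of the \<open>q z\<close>, RIC for \<open>t\<close> forces the fibre over some
  such \<open>z\<close> to meet \<open>Q\<close>.\<close>

lemma open_pi:
  assumes Q: "open Q"
  shows "open (\<pi> ` Q)"
proof -
  obtain M u y0 where M: "minimal_left_ideal M" and u: "u \<in> M" "uadd u u = u" "Y.act u y0 = y0"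
    and R: "\<And>p x. p \<in> M \<Longrightarrow> \<pi> x = Y.act p y0 \<Longrightarrow> x \<in> lsup T p (X.act u ` (\<pi> -` {y0}))"
    using ric_data by blast
  note uu = mli_ultra[OF M u(1)]
  let ?A = "X.act u ` (\<pi> -` {y0})"
  have A: "\<pi> a = y0" if "a \<in> ?A" for a
  proof -
    obtain b where "a = X.act u b" "\<pi> b = y0" using \<open>a \<in> ?A\<close> by auto
    then show ?thesis using pi_act[OF uu, of b] u(3) by simp
  qed
  have "\<exists>q\<in>M. Y.act q y0 = z" for z
  proof -
    obtain r where r: "ultra r" "Y.act r y0 = z" using reachS by blast
    then have "Y.act (uadd r u) y0 = z" using u(3) uu by (simp add: Y.act_uadd)
    then show ?thesis using mli_left[OF M r(1) u(1)] by blast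
  qed
  then obtain q where q: "\<And>z. q z \<in> M" "\<And>z. Y.act (q z) y0 = z"
    unfolding Bex_def using choice[of "\<lambda>z q. q \<in> M \<and> Y.act q y0 = z"] by auto
  note qu = mli_ultra[OF M q(1)]
  have *: "\<exists>V. open V \<and> \<pi> x \<in> V \<and> V \<subseteq> \<pi> ` Q" if x: "x \<in> Q" for x
  proof (rule ccontr)
    assume no: "\<not> ?thesis"
    have "inf (nhds (\<pi> x)) (principal (- \<pi> ` Q)) \<noteq> bot"
    proof
      assume "inf (nhds (\<pi> x)) (principal (- \<pi> ` Q)) = bot"
      then have "eventually (\<lambda>z. False) (inf (nhds (\<pi> x)) (principal (- \<pi> ` Q)))" by simp
      then have "eventually (\<lambda>z. z \<in> \<pi> ` Q) (nhds (\<pi> x))"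
        unfolding eventually_inf_principal by (rule eventually_mono) auto
      then show False using no unfolding eventually_nhds subset_eq by blast
    qed
    then obtain F where F: "ultra F" "F \<le> nhds (\<pi> x)" "F \<le> principal (- \<pi> ` Q)"
      using ex_ultra_le[of "inf (nhds (\<pi> x)) (principal (- \<pi> ` Q))"] by auto
    define t where "t = ubind F q"
    have t: "ultra t" using F(1) qu unfolding t_def by (rule ultra_ubind)
    \<comment> \<open>This is closedness of \<open>M\<close>: absorbing \<open>u\<close> on the
      right survives the limit, and it puts \<open>t\<close> back into the ideal.\<close>
    have "uadd t u = t"
      unfolding t_def filter_eq_iff eventually_uadd eventually_ubind
      by (simp add: mli_right_id[OF M u(1,2) q(1)] flip: eventually_uadd)
    then have tM: "t \<in> M" using mli_left[OF M t u(1)] by simp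
    have ty: "Y.act t y0 = \<pi> x"
    proof (rule ccontr)
      assume "Y.act t y0 \<noteq> \<pi> x"
      then obtain V1 V2 where V: "open V1" "open V2" "Y.act t y0 \<in> V1" "\<pi> x \<in> V2" "V1 \<inter> V2 = {}"
        using hausdorff[of "Y.act t y0" "\<pi> x"] by auto
      have "\<forall>\<^sub>F z in F. \<forall>\<^sub>F k in q z. iter S k y0 \<in> V1"
        using topological_tendstoD[OF Y.act_lim[OF t] V(1,3)] by (simp add: t_def eventually_ubind)
      moreover have "\<forall>\<^sub>F z in F. z \<in> V2"
        by (rule filter_leD[OF F(2) eventually_nhds_in_open[OF V(2,4)]])
      ultimately have "\<forall>\<^sub>F z in F. False"
      proof eventually_elim
        case (elim z)
        have "\<forall>\<^sub>F k in q z. iter S k y0 \<in> V2"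
          using topological_tendstoD[OF Y.act_lim[OF qu] V(2), of z y0] elim q(2) by simp
        with elim(1) have "\<forall>\<^sub>F k in q z. False" by eventually_elim (use V in auto)
        then show ?case using ultra_nonbot[OF qu[of z]] unfolding eventually_False by blast
      qed
      then show False using ultra_nonbot[OF F(1)] unfolding eventually_False by blast
    qed
    \<comment> \<open>The limit \<open>l\<close> found below lies only in the closure of the
      neighbourhood used, so that closure has to stay inside \<open>Q\<close>.\<close>
    obtain Q' where Q': "open Q'" "x \<in> Q'" "closure Q' \<subseteq> Q"
    proof -
      obtain e where e: "0 < e" "cball x e \<subseteq> Q" using Q x open_contains_cball by blast
      have "closure (ball x e) \<subseteq> cball x e" by (intro closure_minimal) auto
      then show thesis using e by (intro that[of "ball x e"]) auto
    qed
    have "\<forall>\<^sub>F z in F. \<forall>\<^sub>F k in q z. iter T k ` ?A \<inter> Q' \<noteq> {}"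
      using lsupD[OF R[OF tM] Q'(1,2)] ty by (simp add: t_def eventually_ubind)
    moreover have "\<forall>\<^sub>F z in F. z \<notin> \<pi> ` Q" using F(3) by (auto simp: le_principal)
    ultimately have "\<forall>\<^sub>F z in F. (\<forall>\<^sub>F k in q z. iter T k ` ?A \<inter> Q' \<noteq> {}) \<and> z \<notin> \<pi> ` Q"
      by (rule eventually_conj)
    then obtain z where z: "\<forall>\<^sub>F k in q z. iter T k ` ?A \<inter> Q' \<noteq> {}" "z \<notin> \<pi> ` Q"
      using eventually_happens'[OF ultra_nonbot[OF F(1)]] by blast
    define a where "a = (\<lambda>k. SOME a. a \<in> ?A \<and> iter T k a \<in> Q')"
    have "\<forall>\<^sub>F k in q z. \<exists>a. a \<in> ?A \<and> iter T k a \<in> Q'"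
      using z(1) by (rule eventually_mono) blast
    then have a: "\<forall>\<^sub>F k in q z. a k \<in> ?A \<and> iter T k (a k) \<in> Q'"
      unfolding a_def by (rule eventually_mono) (rule someI_ex)
    obtain l where l: "((\<lambda>k. iter T k (a k)) \<longlongrightarrow> l) (q z)"
      using ultra_compact_lim[OF qu X.compact_UNIV, of "\<lambda>k. iter T k (a k)" z] by auto
    have "l \<in> closure Q'"
    proof (rule Lim_in_closed_set[OF closed_closure _ ultra_nonbot[OF qu] l])
      show "\<forall>\<^sub>F k in q z. iter T k (a k) \<in> closure Q'"
        using a by (rule eventually_mono) (use closure_subset in blast)
    qed
    moreover have "((\<lambda>k. iter S k y0) \<longlongrightarrow> \<pi> l) (q z)"
    proof (rule Lim_transform_eventually[OF tendsto_pi[OF l]])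
      show "\<forall>\<^sub>F k in q z. \<pi> (iter T k (a k)) = iter S k y0"
        using a by (rule eventually_mono) (simp add: pi_iter A)
    qed
    then have "\<pi> l = z" using act_eqI[OF qu, of S y0 "\<pi> l" z] q(2) by simp
    ultimately show False using z(2) Q'(3) by blast
  qed
  show ?thesis
    unfolding open_subopen[of "\<pi> ` Q"]
  proof
    fix y assume "y \<in> \<pi> ` Q"
    then show "\<exists>V. open V \<and> y \<in> V \<and> V \<subseteq> \<pi> ` Q" using * by blast
  qed
qed

end

section \<open>Points with dense orbit in the fibre relation\<close>

lemma compact_countable_base:
  assumes "compact (UNIV :: 'c::metric_space set)"
  shows "\<exists>\<B> :: 'c set set. countable \<B> \<and> (\<forall>B\<in>\<B>. open B) \<and>
    (\<forall>Q x. open Q \<longrightarrow> x \<in> Q \<longrightarrow> (\<exists>B\<in>\<B>. x \<in> B \<and> B \<subseteq> Q))"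
proof -
  have "\<exists>D :: 'c set. finite D \<and> UNIV = (\<Union>c\<in>D. ball c (inverse (real (Suc k))))" for k
  proof -
    obtain D where "D \<subseteq> UNIV" "finite D" "(UNIV :: 'c set) \<subseteq> (\<Union>c\<in>D. ball c (inverse (real (Suc k))))"
    proof (rule compactE_image[OF assms, of UNIV "\<lambda>c. ball c (inverse (real (Suc k)))"])
      have "x \<in> ball x (inverse (real (Suc k)))" for x :: 'c by simp
      then show "(UNIV :: 'c set) \<subseteq> (\<Union>c\<in>UNIV. ball c (inverse (real (Suc k))))" by blast
    qed auto
    then show ?thesis by blast
  qed
  then obtain D :: "nat \<Rightarrow> 'c set" where D: "\<And>k. finite (D k)"
    "\<And>k. UNIV = (\<Union>c\<in>D k. ball c (inverse (real (Suc k))))" by metis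
  define \<B> where "\<B> = (\<Union>k. (\<lambda>c. ball c (inverse (real (Suc k)))) ` D k)"
  have "countable \<B>" unfolding \<B>_def using D(1) by (auto intro: countable_finite)
  moreover have "\<forall>B\<in>\<B>. open B" by (auto simp: \<B>_def)
  moreover have "\<exists>B\<in>\<B>. x \<in> B \<and> B \<subseteq> Q" if Q: "open Q" "x \<in> Q" for Q x
  proof -
    obtain e where e: "0 < e" "ball x e \<subseteq> Q" using Q open_contains_ball by blast
    obtain k where k: "inverse (real (Suc k)) < e / 2"
      using reals_Archimedean[of "e / 2"] e(1) by auto
    obtain c where c: "c \<in> D k" "x \<in> ball c (inverse (real (Suc k)))" using D(2)[of k] by blast
    have "ball c (inverse (real (Suc k))) \<subseteq> ball x e"
    proof
      fix z assume "z \<in> ball c (inverse (real (Suc k)))"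
      then have "dist x z < e"
        using c(2) k dist_triangle[of x z c] by (simp add: dist_commute)
      then show "z \<in> ball x e" by simp
    qed
    then show ?thesis using c e(2) by (intro bexI[of _ "ball c (inverse (real (Suc k)))"]) (auto simp: \<B>_def)
  qed
  ultimately show ?thesis by blast
qed

lemma Baire_compact:
  fixes R :: "'c::metric_space set"
  assumes R: "compact R" and G: "countable \<G>" "\<And>G. G \<in> \<G> \<Longrightarrow> openin (top_of_set R) G"
    and dense: "\<And>G U. G \<in> \<G> \<Longrightarrow> openin (top_of_set R) U \<Longrightarrow> U \<noteq> {} \<Longrightarrow> G \<inter> U \<noteq> {}"
    and V: "openin (top_of_set R) V" "V \<noteq> {}"
  shows "\<exists>x\<in>V. \<forall>G\<in>\<G>. x \<in> G"
proof -
  have "compact_space (top_of_set R)"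
    using R by (simp add: compact_space_subtopology compactin_euclidean_iff)
  then have "locally_compact_space (top_of_set R)" by (rule compact_imp_locally_compact_space)
  moreover have "regular_space (top_of_set R)"
    by (intro metrizable_imp_regular_space metrizable_space_subtopology metrizable_space_euclidean)
  ultimately have "top_of_set R closure_of \<Inter>\<G> = topspace (top_of_set R)"
  proof (intro Baire_category disjI2 conjI)
    fix G assume "G \<in> \<G>"
    then show "openin (top_of_set R) G" "top_of_set R closure_of G = topspace (top_of_set R)"
      unfolding dense_intersects_open using G(2) dense by blast+
  qed (auto intro: G(1))
  then show ?thesis using V unfolding dense_intersects_open by blast
qed

context csystem
begin

lemma iter_map_prod: "iter (map_prod T T) n (x, y) = (iter T n x, iter T n y)"
proof -
  have pow: "(map_prod f f ^^ k) (a, b) = ((f ^^ k) a, (f ^^ k) b)" for f :: "'a \<Rightarrow> 'a" and k a b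
    by (induction k) auto
  have "map_prod T T \<circ> map_prod (inv T) (inv T) = id" "map_prod (inv T) (inv T) \<circ> map_prod T T = id"
    using bij by (simp_all add: fun_eq_iff bij_is_surj surj_f_inv_f bij_is_inj inv_f_f)
  then have "inv (map_prod T T) = map_prod (inv T) (inv T)" by (rule inv_unique_comp)
  then show ?thesis by (simp add: iter_def pow)
qed

lemma act_iff_le: "ultra p \<Longrightarrow> p \<le> filtercomap (\<lambda>k. iter T k x) (nhds y) \<longleftrightarrow> act p x = y"
  using act_eqI[of p T x y] act_lim[of p x]
  unfolding filterlim_def filtermap_le_iff_le_filtercomap by blast

end

locale wm_ext = ric_ext +
  assumes wm: "weakly_mixing_extension T \<pi>"
begin

lemma compact_fiber_rel: "compact (fiber_rel \<pi>)"
proof -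
  have "closed {z :: 'a \<times> 'a. \<pi> (fst z) = \<pi> (snd z)}"
    by (intro closed_Collect_eq continuous_on_compose2[OF cont_pi]) (auto intro: continuous_intros)
  moreover have "fiber_rel \<pi> = {z. \<pi> (fst z) = \<pi> (snd z)}" by (auto simp: fiber_rel_def)
  ultimately have "closed (fiber_rel \<pi>)" by simp
  moreover have "compact (UNIV :: ('a \<times> 'a) set)"
    using compact_Times[OF X.compact_UNIV X.compact_UNIV] by simp
  ultimately show ?thesis using compact_Int_closed[of UNIV "fiber_rel \<pi>"] by simp
qed

text \<open>By transitivity, the pairs whose orbit visits a given basic open set form an open dense
  subset of the fibre relation. Baire gives a pair with dense orbit, and ultrafilters realise its
  limits.\<close>

lemma ex_transitive_pair:
  obtains x x' where "\<pi> x = \<pi> x'"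
    "\<forall>a b. \<pi> a = \<pi> b \<longrightarrow> (\<exists>p. ultra p \<and> X.act p x = a \<and> X.act p x' = b)"
proof -
  let ?R = "fiber_rel \<pi>" and ?F = "iter (map_prod T T)"
  have "compact (UNIV :: ('a \<times> 'a) set)"
    using compact_Times[OF X.compact_UNIV X.compact_UNIV] by simp
  then obtain \<B> :: "('a \<times> 'a) set set" where B: "countable \<B>" "\<And>B. B \<in> \<B> \<Longrightarrow> open B"
    "\<And>Q x. open Q \<Longrightarrow> x \<in> Q \<Longrightarrow> \<exists>B\<in>\<B>. x \<in> B \<and> B \<subseteq> Q"
    using compact_countable_base by metis
  define g where "g = (\<lambda>B. ?R \<inter> (\<Union>n. ?F n -` B))"
  have cont: "continuous_on UNIV (?F n)" for n
  proof -
    have "?F n = (\<lambda>z. (iter T n (fst z), iter T n (snd z)))"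
      by (auto simp: fun_eq_iff X.iter_map_prod)
    then show ?thesis
      by (auto intro!: continuous_on_Pair continuous_on_compose2[OF X.cont_iter] continuous_intros)
  qed
  have "\<exists>z\<in>?R. \<forall>G\<in>g ` {B \<in> \<B>. B \<inter> ?R \<noteq> {}}. z \<in> G"
  proof (rule Baire_compact[OF compact_fiber_rel])
    show "countable (g ` {B \<in> \<B>. B \<inter> ?R \<noteq> {}})" using B(1) by auto
    show "openin (top_of_set ?R) ?R" by simp
    show "?R \<noteq> {}" by (auto simp: fiber_rel_def)
  next
    fix G assume "G \<in> g ` {B \<in> \<B>. B \<inter> ?R \<noteq> {}}"
    then obtain C where C: "C \<in> \<B>" "C \<inter> ?R \<noteq> {}" "G = g C" by blast
    have "open (\<Union>n. ?F n -` C)" using open_vimage[OF B(2)[OF C(1)] cont] by blast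
    then show "openin (top_of_set ?R) G" by (auto simp: C(3) g_def openin_open_Int)
    fix U assume U: "openin (top_of_set ?R) U" "U \<noteq> {}"
    have "openin (top_of_set ?R) (?R \<inter> C)" using B(2)[OF C(1)] by (rule openin_open_Int)
    then obtain n where "U \<inter> ?F n -` (?R \<inter> C) \<noteq> {}"
      using wm U C(2) unfolding weakly_mixing_extension_def transitive_on_def by blast
    then show "G \<inter> U \<noteq> {}" using openin_imp_subset[OF U(1)] by (auto simp: C(3) g_def)
  qed
  then obtain x x' where x: "\<pi> x = \<pi> x'" "\<And>C. C \<in> \<B> \<Longrightarrow> C \<inter> ?R \<noteq> {} \<Longrightarrow> (x, x') \<in> g C"
    by (auto simp: fiber_rel_def)
  have "\<exists>p. ultra p \<and> X.act p x = a \<and> X.act p x' = b" if ab: "\<pi> a = \<pi> b" for a b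
  proof -
    have "\<exists>p. ultra p \<and> ((\<lambda>n. (iter T n x, iter T n x')) \<longlongrightarrow> (a, b)) p"
    proof (rule ex_ultra_lim)
      fix Q :: "('a \<times> 'a) set" assume "open Q" "(a, b) \<in> Q"
      then obtain C where C: "C \<in> \<B>" "(a, b) \<in> C" "C \<subseteq> Q" using B(3) by blast
      then have "(x, x') \<in> g C" using ab by (intro x(2)) (auto simp: fiber_rel_def)
      then obtain n where "?F n (x, x') \<in> C" by (auto simp: g_def)
      then show "\<exists>n. (iter T n x, iter T n x') \<in> Q" using C(3) by (auto simp: X.iter_map_prod)
    qed
    then obtain p where p: "ultra p" "((\<lambda>n. (iter T n x, iter T n x')) \<longlongrightarrow> (a, b)) p" by blast
    show ?thesis
      using p(1) act_eqI[OF p(1), of T x a] act_eqI[OF p(1), of T x' b]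
        tendsto_fst[OF p(2)] tendsto_snd[OF p(2)] by auto
  qed
  then show thesis using that x(1) by blast
qed

text \<open>
  The two points of a transitive pair are proximal, so a whole minimal left ideal identifies
  them; it contains an idempotent fixing the second one.
\<close>

lemma ex_proximal_pair:
  obtains x x' M u where "minimal_left_ideal M" "u \<in> M" "uadd u u = u"
    "X.act u x = x'" "X.act u x' = x'" "\<pi> x = \<pi> x'"
    "\<forall>a b. \<pi> a = \<pi> b \<longrightarrow> (\<exists>p. ultra p \<and> X.act p x = a \<and> X.act p x' = b)"
proof -
  obtain x x' where x: "\<pi> x = \<pi> x'"
    "\<forall>a b. \<pi> a = \<pi> b \<longrightarrow> (\<exists>p. ultra p \<and> X.act p x = a \<and> X.act p x' = b)"
    by (rule ex_transitive_pair)
  \<comment> \<open>The pair is sent to a diagonal point, so every element of the translate of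
    \<open>M0\<close> by \<open>p\<close> identifies \<open>x\<close> and \<open>x'\<close>.\<close>
  obtain p where p: "ultra p" "X.act p x = x'" "X.act p x' = x'" using x(2) by blast
  obtain M0 u0 y0 where M0: "minimal_left_ideal M0" "u0 \<in> M0" using ric_data by metis
  define M where "M = (\<lambda>m. uadd m p) ` M0"
  have M: "minimal_left_ideal M" unfolding M_def using M0(1) p(1) by (rule mli_translate)
  have same: "X.act q x = X.act q x'" if q: "q \<in> M" for q
  proof -
    obtain m where "m \<in> M0" "q = uadd m p" using q by (auto simp: M_def)
    then show ?thesis using p mli_ultra[OF M0(1), of m] by (simp add: X.act_uadd)
  qed
  have q0: "uadd u0 p \<in> M" using M0 by (simp add: M_def)
  define q where "q = uadd u0 p"
  have q: "q \<in> M" "ultra q" using q0 mli_ultra[OF M q0] by (simp_all add: q_def)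
  \<comment> \<open>The ultrafilters below \<open>F\<close> are the elements of the left ideal
    generated by \<open>q\<close> that fix \<open>x'\<close>: a closed subsemigroup, nonempty
    because minimality of \<open>T\<close> brings the image of \<open>x'\<close> under
    \<open>q\<close> back to \<open>x'\<close>.\<close>
  define F where "F = inf (uadd top q) (filtercomap (\<lambda>k. iter T k x') (nhds x'))"
  have le_F: "s \<le> F \<longleftrightarrow> (\<exists>t. ultra t \<and> s = uadd t q) \<and> X.act s x' = x'" if s: "ultra s" for s
  proof -
    have "s \<le> uadd top q \<longleftrightarrow> (\<exists>t. ultra t \<and> s = uadd t q)"
    proof
      assume "s \<le> uadd top q"
      then show "\<exists>t. ultra t \<and> s = uadd t q" using ultra_le_uaddE[OF s q(2)] by blast
    next
      assume "\<exists>t. ultra t \<and> s = uadd t q"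
      then show "s \<le> uadd top q" by (auto intro: uadd_mono)
    qed
    then show ?thesis using X.act_iff_le[OF s] by (simp add: F_def)
  qed
  obtain r where r: "ultra r" "X.act r (X.act q x') = x'" using reachT by blast
  have "ultra (uadd r q)" using r(1) q(2) by (rule ultra_uadd)
  moreover have "uadd r q \<le> F"
    using le_F[OF calculation] r q(2) by (auto simp: X.act_uadd)
  ultimately have "F \<noteq> bot" using le_bot[of "uadd r q"] ultra_nonbot[of "uadd r q"] by auto
  then have "\<exists>e. ultra e \<and> e \<le> F \<and> uadd e e = e"
  proof (rule Ellis_idempotent)
    fix s t assume st: "ultra s" "ultra t" "s \<le> F" "t \<le> F"
    obtain t' where t': "ultra t'" "t = uadd t' q" using le_F[OF st(2)] st(4) by blast
    have "uadd s t = uadd (uadd s t') q" by (simp add: t'(2) uadd_assoc)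
    moreover have "X.act (uadd s t) x' = x'"
      using le_F[OF st(1)] le_F[OF st(2)] st by (simp add: X.act_uadd)
    ultimately show "uadd s t \<le> F"
      using le_F[OF ultra_uadd[OF st(1,2)]] ultra_uadd[OF st(1) t'(1)] by blast
  qed
  then obtain u where u: "ultra u" "u \<le> F" "uadd u u = u" by blast
  then obtain t where t: "ultra t" "u = uadd t q" "X.act u x' = x'" using le_F[OF u(1)] by blast
  have "u \<in> M" using mli_left[OF M t(1) q(1)] t(2) by simp
  then show thesis using that[OF M _ u(3) _ t(3) x(1) x(2)] same[of u] t(3) by simp
qed

section \<open>Irreducibility of the fixed points in a fibre\<close>

text \<open>A proximal pair \<open>x\<close>, \<open>x'\<close> is mapped to \<open>a\<close>,
  \<open>b\<close>. Since \<open>x\<close> is a limit of \<open>u\<close>-fixed points, it is a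
  limit coming from one of the two pieces, and transporting this to \<open>w\<close> puts both
  \<open>a\<close> and \<open>b\<close> into that piece.\<close>

lemma irreducible_pair:
  assumes w: "min_idem w" and y: "Y.act w y = y"
    and ab: "a \<in> fixpts w y" "b \<in> fixpts w y"
    and cover: "fixpts w y \<subseteq> B1 \<union> B2"
    and cl: "lsup T w (B1 \<inter> fixpts w y) \<inter> fixpts w y \<subseteq> B1"
      "lsup T w (B2 \<inter> fixpts w y) \<inter> fixpts w y \<subseteq> B2"
  shows "(a \<in> B1 \<and> b \<in> B1) \<or> (a \<in> B2 \<and> b \<in> B2)"
proof -
  let ?A = "fixpts w y"
  obtain x x' M u where M: "minimal_left_ideal M" and u: "u \<in> M" "uadd u u = u"
    and x: "X.act u x = x'" "X.act u x' = x'" "\<pi> x = \<pi> x'"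
    and tr: "\<forall>a b. \<pi> a = \<pi> b \<longrightarrow> (\<exists>p. ultra p \<and> X.act p x = a \<and> X.act p x' = b)"
    by (rule ex_proximal_pair)
  note uu = mli_ultra[OF M u(1)] and wu = min_idem_ultra[OF w]
  have ww: "uadd w w = w" using w by (simp add: min_idem_def)
  have fa: "X.act w a = a" "X.act w b = b" "\<pi> a = y" "\<pi> b = y" using ab by (auto simp: fixpts_def)
  obtain p where p: "ultra p" "X.act p x = a" "X.act p x' = b"
    using tr trans[OF fa(3) fa(4)[symmetric]] by blast
  define y' where "y' = \<pi> x'"
  have uy: "Y.act u y' = y'" using pi_act[OF uu, of x'] x(2) by (simp add: y'_def)
  have py: "Y.act p y' = y" using pi_act[OF p(1), of x'] p(3) fa(4) by (simp add: y'_def)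
  \<comment> \<open>A version of \<open>p\<close> lying in \<open>M\<close> and absorbed by
    \<open>w\<close>, so that it moves \<open>u\<close>-fixed points over \<open>y'\<close> to
    \<open>w\<close>-fixed points over \<open>y\<close>.\<close>
  define q where "q = uadd w (uadd p u)"
  have q: "q \<in> M" "ultra q" "uadd w q = q"
    using mli_left[OF M wu mli_left[OF M p(1) u(1)]] p(1) wu uu
    by (auto simp: q_def ww ultra_uadd simp flip: uadd_assoc)
  have qu: "uadd q u = q" using mli_right_id[OF M u q(1)] .
  have qy: "Y.act q y' = y" using p(1) wu uu uy py y by (simp add: q_def Y.act_uadd ultra_uadd)
  obtain r where r: "ultra r" "uadd r q = u" "uadd q r = w"
    using min_idem_transport[OF M u q(1) w q(3)] by blast
  have "fixpts u y' \<subseteq> X.act r ` ?A"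
  proof
    fix c assume "c \<in> fixpts u y'"
    then have c: "X.act u c = c" "\<pi> c = y'" by (auto simp: fixpts_def)
    have "c = X.act r (X.act q c)" using r q(2) c(1) by (simp flip: X.act_uadd)
    moreover have "X.act w (X.act q c) = X.act q c" using q wu by (simp flip: X.act_uadd)
    moreover have "\<pi> (X.act q c) = y" using pi_act[OF q(2)] c(2) qy by simp
    ultimately show "c \<in> X.act r ` ?A" by (auto simp: fixpts_def)
  qed
  then have "lsup T u (fixpts u y') \<subseteq> lsup T (uadd u r) ?A"
    by (rule order_trans[OF lsup_mono X.lsup_act_image[OF r(1)]])
  moreover have "min_idem u" using M u by (auto simp: min_idem_def)
  then have "x \<in> lsup T u (fixpts u y')"
    using fiber_lsup[OF _ uy] x(3) by (simp add: y'_def)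
  ultimately have "x \<in> lsup T (uadd u r) ?A" by blast
  moreover have "?A \<subseteq> (\<Union>B\<in>{B1, B2}. B \<inter> ?A)" using cover by blast
  then have "lsup T (uadd u r) ?A \<subseteq> lsup T (uadd u r) (\<Union>B\<in>{B1, B2}. B \<inter> ?A)" by (rule lsup_mono)
  ultimately have "x \<in> lsup T (uadd u r) (\<Union>B\<in>{B1, B2}. B \<inter> ?A)" by blast
  from lsup_UN_finite[OF ultra_uadd[OF uu r(1)] _ this]
  obtain B where B: "x \<in> lsup T (uadd u r) (B \<inter> ?A)" "B = B1 \<or> B = B2" by auto
  have clB: "lsup T w (B \<inter> ?A) \<inter> ?A \<subseteq> B" using B(2) cl by blast
  \<comment> \<open>Applying \<open>uadd w p\<close> to \<open>x\<close> gives \<open>a\<close>,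
    while \<open>q\<close> gives \<open>b\<close> because \<open>u\<close> first turns
    \<open>x\<close> into \<open>x'\<close>. Both sums with \<open>uadd u r\<close> collapse to
    \<open>w\<close>, so the same limit set contains \<open>a\<close> and \<open>b\<close>.\<close>
  have "X.act (uadd w p) x \<in> lsup T (uadd (uadd w p) (uadd u r)) (B \<inter> ?A)"
    using X.act_lsup[OF ultra_uadd[OF wu p(1)] B(1)] .
  moreover have "uadd (uadd w p) (uadd u r) = w" using r(3) by (simp add: q_def uadd_assoc)
  moreover have "X.act (uadd w p) x = a" using wu p fa by (simp add: X.act_uadd)
  ultimately have "a \<in> lsup T w (B \<inter> ?A)" by simp
  then have "a \<in> B" using clB ab(1) by blast
  have "X.act q x \<in> lsup T (uadd q (uadd u r)) (B \<inter> ?A)" using X.act_lsup[OF q(2) B(1)] .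
  moreover have "uadd q (uadd u r) = w" using r(3) qu by (simp flip: uadd_assoc)
  moreover have "X.act q x = b"
    using wu p uu x(1) fa(2) by (simp add: q_def X.act_uadd ultra_uadd)
  ultimately have "b \<in> lsup T w (B \<inter> ?A)" by simp
  then have "b \<in> B" using clB ab(2) by blast
  then show ?thesis using \<open>a \<in> B\<close> B(2) by blast
qed

lemma fixpts_nonempty:
  assumes w: "min_idem w" and y: "Y.act w y = y"
  shows "fixpts w y \<noteq> {}"
proof -
  note wu = min_idem_ultra[OF w]
  obtain x where x: "\<pi> x = y" using surj_pi by (metis surjD)
  have "uadd w w = w" using w by (simp add: min_idem_def)
  then have "X.act w (X.act w x) = X.act w x" using wu by (simp flip: X.act_uadd)
  moreover have "\<pi> (X.act w x) = y" using pi_act[OF wu] x y by simp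
  ultimately show ?thesis by (auto simp: fixpts_def)
qed

text \<open>If \<open>a\<close> lies outside \<open>B i\<close>, the pairwise statement puts every
  other fixed point into the union of the remaining pieces, and induction applies to these.\<close>

lemma irreducible:
  assumes w: "min_idem w" and y: "Y.act w y = y"
    and "finite I" "fixpts w y \<subseteq> (\<Union>i\<in>I. B i)"
    and "\<And>i. i \<in> I \<Longrightarrow> lsup T w (B i \<inter> fixpts w y) \<inter> fixpts w y \<subseteq> B i"
  shows "\<exists>i\<in>I. fixpts w y \<subseteq> B i"
  using assms(3-5)
proof (induction I)
  case empty
  then show ?case using fixpts_nonempty[OF w y] by blast
next
  case (insert i I)
  show ?case
  proof (cases "fixpts w y \<subseteq> B i")
    case False
    then obtain a where a: "a \<in> fixpts w y" "a \<notin> B i" by blast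
    let ?C = "\<Union>i\<in>I. B i"
    have "fixpts w y \<subseteq> ?C"
    proof
      fix b assume b: "b \<in> fixpts w y"
      have "lsup T w (?C \<inter> fixpts w y) \<inter> fixpts w y \<subseteq> ?C"
      proof
        fix c assume c: "c \<in> lsup T w (?C \<inter> fixpts w y) \<inter> fixpts w y"
        have "?C \<inter> fixpts w y = (\<Union>i\<in>I. B i \<inter> fixpts w y)" by blast
        then have "\<exists>i\<in>I. c \<in> lsup T w (B i \<inter> fixpts w y)"
          using c lsup_UN_finite[OF min_idem_ultra[OF w] insert.hyps(1), of c T "\<lambda>i. B i \<inter> fixpts w y"]
          by auto
        then show "c \<in> ?C" using c insert.prems(2) by blast
      qed
      moreover have "lsup T w (B i \<inter> fixpts w y) \<inter> fixpts w y \<subseteq> B i" using insert.prems(2) by blast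
      moreover have "fixpts w y \<subseteq> B i \<union> ?C" using insert.prems(1) by blast
      ultimately show "b \<in> ?C" using irreducible_pair[OF w y a(1) b, of "B i" ?C] a(2) by blast
    qed
    then show ?thesis using insert.IH insert.prems(2) by blast
  qed blast
qed

text \<open>Irreducibility exchanges the quantifiers. If every \<open>x\<close> failed at some
  \<open>\<alpha> x\<close>, then it would do so on a neighbourhood \<open>N x\<close>. Finitely
  many of these cover the space, so the sets of \<open>a\<close> served by their closures cover the
  fixed points; one of them is everything, including \<open>\<alpha> x\<close>.\<close>

lemma uniform_choice:
  fixes \<Psi> :: "'a \<Rightarrow> 'a \<Rightarrow> bool"
  assumes w: "min_idem w" and y: "Y.act w y = y"
    and ex: "\<And>a. a \<in> fixpts w y \<Longrightarrow> \<exists>x. \<Psi> x a"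
    and closed: "\<And>a. closed {x. \<Psi> x a}"
    and lim: "\<And>G \<xi> a x. ultra G \<Longrightarrow> filtermap fst G = w \<Longrightarrow> \<forall>\<^sub>F g in G. \<Psi> (\<xi> g) (snd g) \<Longrightarrow>
      ((\<lambda>g. iter T (fst g) (snd g)) \<longlongrightarrow> a) G \<Longrightarrow> (\<xi> \<longlongrightarrow> x) G \<Longrightarrow> \<Psi> x a"
  shows "\<exists>x. \<forall>a\<in>fixpts w y. \<Psi> x a"
proof (rule ccontr)
  assume "\<not> ?thesis"
  then obtain \<alpha> where \<alpha>: "\<And>x. \<alpha> x \<in> fixpts w y" "\<And>x. \<not> \<Psi> x (\<alpha> x)" by metis
  have "\<exists>O'. open O' \<and> x \<in> O' \<and> (\<forall>z\<in>closure O'. \<not> \<Psi> z (\<alpha> x))" for x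
  proof -
    have "open (- {z. \<Psi> z (\<alpha> x)})" "x \<in> - {z. \<Psi> z (\<alpha> x)}" using closed \<alpha>(2) by auto
    then obtain e where e: "0 < e" "cball x e \<subseteq> - {z. \<Psi> z (\<alpha> x)}" using open_contains_cball by blast
    have "closure (ball x e) \<subseteq> cball x e" by (intro closure_minimal) auto
    then show ?thesis using e by (intro exI[of _ "ball x e"]) auto
  qed
  then obtain N where N: "\<And>x. open (N x)" "\<And>x. x \<in> N x" "\<And>x z. z \<in> closure (N x) \<Longrightarrow> \<not> \<Psi> z (\<alpha> x)"
    by metis
  obtain D where D: "finite D" "UNIV = (\<Union>x\<in>D. N x)"
  proof (rule compactE_image[OF X.compact_UNIV, of UNIV N])
    show "UNIV \<subseteq> (\<Union>x\<in>UNIV. N x)" using N(2) by blast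
  qed (use N(1) in blast)+
  define B where "B = (\<lambda>x. {a. \<exists>z\<in>closure (N x). \<Psi> z a})"
  have "\<exists>x\<in>D. fixpts w y \<subseteq> B x"
  proof (rule irreducible[OF w y D(1)])
    show "fixpts w y \<subseteq> (\<Union>x\<in>D. B x)"
    proof
      fix a assume "a \<in> fixpts w y"
      then obtain z where z: "\<Psi> z a" using ex by blast
      obtain x where "x \<in> D" "z \<in> N x" using D(2) by blast
      then show "a \<in> (\<Union>x\<in>D. B x)" using z closure_subset[of "N x"] by (auto simp: B_def)
    qed
    fix x assume "x \<in> D"
    show "lsup T w (B x \<inter> fixpts w y) \<inter> fixpts w y \<subseteq> B x"
    proof
      fix a assume "a \<in> lsup T w (B x \<inter> fixpts w y) \<inter> fixpts w y"
      then have a: "a \<in> lsup T w (B x \<inter> fixpts w y)" by blast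
      obtain G where G: "ultra G" "filtermap fst G = w" "\<forall>\<^sub>F g in G. snd g \<in> B x \<inter> fixpts w y"
        "((\<lambda>g. iter T (fst g) (snd g)) \<longlongrightarrow> a) G"
        using lsup_ultra[OF min_idem_ultra[OF w] a] by blast
      \<comment> \<open>The parameters are chosen in a compact set, so they converge along
        \<open>G\<close> and the limit hypothesis transfers to \<open>a\<close>.\<close>
      define \<xi> where "\<xi> = (\<lambda>g :: int \<times> 'a. SOME z. z \<in> closure (N x) \<and> \<Psi> z (snd g))"
      have "\<forall>\<^sub>F g in G. \<exists>z. z \<in> closure (N x) \<and> \<Psi> z (snd g)"
        using G(3) by (rule eventually_mono) (auto simp: B_def)
      then have \<xi>: "\<forall>\<^sub>F g in G. \<xi> g \<in> closure (N x) \<and> \<Psi> (\<xi> g) (snd g)"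
        unfolding \<xi>_def by (rule eventually_mono) (rule someI_ex)
      have "compact (closure (N x))"
        using compact_Int_closed[OF X.compact_UNIV closed_closure[of "N x"]] by simp
      moreover have "\<forall>\<^sub>F g in G. \<xi> g \<in> closure (N x)" using \<xi> by (rule eventually_mono) blast
      ultimately obtain z where z: "z \<in> closure (N x)" "(\<xi> \<longlongrightarrow> z) G"
        using ultra_compact_lim[OF G(1)] by blast
      have "\<forall>\<^sub>F g in G. \<Psi> (\<xi> g) (snd g)" using \<xi> by (rule eventually_mono) blast
      from lim[OF G(1,2) this G(4) z(2)] show "a \<in> B x" using z(1) by (auto simp: B_def)
    qed
  qed
  then obtain x where "fixpts w y \<subseteq> B x" by blast
  then have "\<alpha> x \<in> B x" using \<alpha>(1) by blast
  then show False using N(3) by (auto simp: B_def)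
qed

end

section \<open>Arithmetic progressions in orbits\<close>

lemma ex_ultra_lim_finite:
  assumes I: "finite I"
    and near: "\<And>U. \<forall>i\<in>I. open (U i) \<and> y i \<in> U i \<Longrightarrow> \<exists>z. \<forall>i\<in>I. f i z \<in> U i"
  shows "\<exists>G. ultra G \<and> (\<forall>i\<in>I. (f i \<longlongrightarrow> y i) G)"
proof -
  define H where "H = (INF i\<in>I. filtercomap (f i) (nhds (y i)))"
  have "H \<noteq> bot"
  proof
    assume "H = bot"
    then have "eventually (\<lambda>_. False) H" by simp
    then obtain Q where Q: "\<And>i. i \<in> I \<Longrightarrow> eventually (Q i) (filtercomap (f i) (nhds (y i)))"
      "\<And>z. \<not> (\<forall>i\<in>I. Q i z)"
      unfolding H_def eventually_INF_finite[OF I] by blast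
    have "\<forall>i\<in>I. \<exists>U. open U \<and> y i \<in> U \<and> (\<forall>z. f i z \<in> U \<longrightarrow> Q i z)"
    proof
      fix i assume "i \<in> I"
      from Q(1)[OF this] show "\<exists>U. open U \<and> y i \<in> U \<and> (\<forall>z. f i z \<in> U \<longrightarrow> Q i z)"
        unfolding eventually_filtercomap eventually_nhds by blast
    qed
    then obtain U where U: "\<forall>i\<in>I. open (U i) \<and> y i \<in> U i \<and> (\<forall>z. f i z \<in> U i \<longrightarrow> Q i z)"
      using bchoice[of I "\<lambda>i U. open U \<and> y i \<in> U \<and> (\<forall>z. f i z \<in> U \<longrightarrow> Q i z)"] by blast
    then obtain z where "\<forall>i\<in>I. f i z \<in> U i" using near[of U] by blast
    then show False using Q(2)[of z] U by blast
  qed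
  then obtain G where G: "ultra G" "G \<le> H" using ex_ultra_le by blast
  then have "\<forall>i\<in>I. (f i \<longlongrightarrow> y i) G"
    unfolding filterlim_def filtermap_le_iff_le_filtercomap H_def le_INF_iff by blast
  then show ?thesis using G(1) by blast
qed

text \<open>The residue modulo \<open>c\<close> is constant along the ultrafilter, and idempotence
  makes this residue its own double, hence zero.\<close>

lemma idempotent_dvd:
  fixes c :: int
  assumes w: "ultra w" "uadd w w = w" and c: "c \<noteq> 0"
  shows "\<forall>\<^sub>F k in w. c dvd k"
proof -
  have "\<forall>\<^sub>F k in w. \<exists>r\<in>{0..<\<bar>c\<bar>}. k mod \<bar>c\<bar> = r"
    using c by (intro always_eventually) auto
  from ultra_Bex_finite[OF w(1) _ this] obtain r where r: "\<forall>\<^sub>F k in w. k mod \<bar>c\<bar> = r" by auto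
  then have "\<forall>\<^sub>F k in uadd w w. k mod \<bar>c\<bar> = r" using w(2) by simp
  then have "\<forall>\<^sub>F m in w. \<forall>\<^sub>F n in w. (m + n) mod \<bar>c\<bar> = r" by (simp add: eventually_uadd)
  then have "\<forall>\<^sub>F m in w. m mod \<bar>c\<bar> = r \<and> (\<forall>\<^sub>F n in w. (m + n) mod \<bar>c\<bar> = r)"
    using r by (simp add: eventually_conj_iff)
  then obtain m where m: "m mod \<bar>c\<bar> = r" "\<forall>\<^sub>F n in w. (m + n) mod \<bar>c\<bar> = r"
    using eventually_happens'[OF ultra_nonbot[OF w(1)]] by blast
  then have "\<forall>\<^sub>F n in w. n mod \<bar>c\<bar> = r \<and> (m + n) mod \<bar>c\<bar> = r"
    using r by (simp add: eventually_conj_iff)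
  then obtain n where n: "n mod \<bar>c\<bar> = r" "(m + n) mod \<bar>c\<bar> = r"
    using eventually_happens'[OF ultra_nonbot[OF w(1)]] by blast
  then have "(m + n) mod \<bar>c\<bar> = n mod \<bar>c\<bar>" by simp
  then have "\<bar>c\<bar> dvd m" by (simp add: mod_eq_dvd_iff)
  then have "r = 0" using m(1) by simp
  then have "\<bar>c\<bar> dvd k" if "k mod \<bar>c\<bar> = r" for k
    using that mod_0_imp_dvd[of k "\<bar>c\<bar>"] by simp
  then show ?thesis using eventually_mono[OF r, of "\<lambda>k. \<bar>c\<bar> dvd k"] by simp
qed

lemma idempotent_scale:
  fixes v :: "int filter"
  assumes "uadd v v = v"
  shows "uadd (filtermap ((*) c) v) (filtermap ((*) c) v) = filtermap ((*) c) v"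
  using filtermap_uadd[of "(*) c" v v] assms by (simp add: distrib_left)

text \<open>Division by \<open>c\<close> is additive on multiples of \<open>c\<close>, where
  \<open>w\<close> concentrates. So \<open>w\<close> is \<open>c\<close> times an idempotent
  \<open>v\<close>, which lets one \<open>v\<close> drive all coordinates while coordinate
  \<open>j\<close> sees exactly \<open>w\<close>.\<close>

lemma idempotent_unscale:
  fixes c :: int
  assumes w: "ultra w" "uadd w w = w" and c: "c \<noteq> 0"
  defines "v \<equiv> filtermap (\<lambda>k. k div c) w"
  shows "ultra v" "uadd v v = v" "filtermap ((*) c) v = w"
proof -
  note dvd = idempotent_dvd[OF w c]
  show "ultra v" unfolding v_def using w(1) by (rule ultra_filtermap)
  show "filtermap ((*) c) v = w"
  proof (rule filter_eqI)
    fix P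
    have "(\<forall>\<^sub>F k in w. P (c * (k div c))) \<longleftrightarrow> eventually P w"
      using dvd by (intro eventually_subst) (auto elim!: eventually_mono)
    then show "eventually P (filtermap ((*) c) v) \<longleftrightarrow> eventually P w"
      by (simp add: v_def eventually_filtermap)
  qed
  show "uadd v v = v"
  proof (rule filter_eqI)
    fix P
    have "eventually P (uadd v v) \<longleftrightarrow> (\<forall>\<^sub>F m in w. \<forall>\<^sub>F n in w. P (m div c + n div c))"
      by (simp add: v_def eventually_uadd eventually_filtermap)
    also have "\<dots> \<longleftrightarrow> (\<forall>\<^sub>F m in w. \<forall>\<^sub>F n in w. P ((m + n) div c))"
    proof (rule eventually_subst)
      show "\<forall>\<^sub>F m in w. (\<forall>\<^sub>F n in w. P (m div c + n div c)) = (\<forall>\<^sub>F n in w. P ((m + n) div c))"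
        using dvd
      proof eventually_elim
        case (elim m)
        show ?case
          using dvd by (intro eventually_subst) (auto elim!: eventually_mono simp: div_plus_div_distrib_dvd_left elim)
      qed
    qed
    also have "\<dots> \<longleftrightarrow> eventually (\<lambda>k. P (k div c)) (uadd w w)" by (simp add: eventually_uadd)
    also have "\<dots> \<longleftrightarrow> eventually P v" by (simp add: w(2) v_def eventually_filtermap)
    finally show "eventually P (uadd v v) \<longleftrightarrow> eventually P v" .
  qed
qed

section \<open>The closure of the set of progressions\<close>

context csystem
begin

lemma iter_collect: "a + b = c + d \<Longrightarrow> iter T a (iter T b x) = iter T c (iter T d x)"
  by (simp only: iter_add[symmetric])

lemma iter_collect1: "a = c + d \<Longrightarrow> iter T a x = iter T c (iter T d x)"
  by (simp only: iter_add[symmetric])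

text \<open>Membership in the closure of the set of progressions \<open>(T\<^sup>i\<^sup>n x)\<close>, \<open>i\<in>I\<close>.\<close>

definition prog :: "int set \<Rightarrow> (int \<Rightarrow> 'a) \<Rightarrow> bool" where
  "prog I f \<longleftrightarrow> (\<forall>U. (\<forall>i\<in>I. open (U i) \<and> f i \<in> U i) \<longrightarrow> (\<exists>x n. \<forall>i\<in>I. iter T (i * n) x \<in> U i))"

lemma progD: "prog I f \<Longrightarrow> \<forall>i\<in>I. open (U i) \<and> f i \<in> U i \<Longrightarrow> \<exists>x n. \<forall>i\<in>I. iter T (i * n) x \<in> U i"
  by (simp add: prog_def)

lemma prog_diag: "prog I (\<lambda>_. x)"
  unfolding prog_def by (intro allI impI exI[of _ x] exI[of _ 0]) simp

lemma prog_cong: "prog I f \<Longrightarrow> (\<And>i. i \<in> I \<Longrightarrow> f i = g i) \<Longrightarrow> prog I g"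
  by (simp add: prog_def)

lemma prog_subset:
  assumes "prog I f" "J \<subseteq> I"
  shows "prog J f"
  unfolding prog_def
proof (intro allI impI)
  fix U assume "\<forall>i\<in>J. open (U i) \<and> f i \<in> U i"
  then have "\<forall>i\<in>I. open (if i \<in> J then U i else UNIV) \<and> f i \<in> (if i \<in> J then U i else UNIV)" by simp
  from progD[OF assms(1) this] show "\<exists>x n. \<forall>i\<in>J. iter T (i * n) x \<in> U i" using assms(2) by (metis subsetD)
qed

lemma prog_lim:
  assumes "finite I" "G \<noteq> bot" "\<forall>\<^sub>F g in G. prog I (F g)"
    and lim: "\<And>i. i \<in> I \<Longrightarrow> ((\<lambda>g. F g i) \<longlongrightarrow> f i) G"
  shows "prog I f"
  unfolding prog_def
proof (intro allI impI)
  fix U assume U: "\<forall>i\<in>I. open (U i) \<and> f i \<in> U i"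
  then have "\<forall>\<^sub>F g in G. \<forall>i\<in>I. F g i \<in> U i"
    by (intro eventually_ball_finite[OF assms(1)] ballI topological_tendstoD[OF lim]) auto
  then have "\<forall>\<^sub>F g in G. prog I (F g) \<and> (\<forall>i\<in>I. F g i \<in> U i)"
    using assms(3) by (simp add: eventually_conj_iff)
  then obtain g where "prog I (F g)" "\<forall>i\<in>I. F g i \<in> U i"
    using eventually_happens'[OF assms(2)] by blast
  then show "\<exists>x n. \<forall>i\<in>I. iter T (i * n) x \<in> U i" using U by (intro progD) auto
qed

lemma prog_shift:
  assumes "prog I f"
  shows "prog I (\<lambda>i. iter T (m + i * n) (f i))"
  unfolding prog_def
proof (intro allI impI)
  fix U assume "\<forall>i\<in>I. open (U i) \<and> iter T (m + i * n) (f i) \<in> U i"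
  then have "\<forall>i\<in>I. open (iter T (m + i * n) -` U i) \<and> f i \<in> iter T (m + i * n) -` U i"
    by (simp add: open_vimage_iter)
  from progD[OF assms this]
  obtain x k where xk: "\<forall>i\<in>I. iter T (i * k) x \<in> iter T (m + i * n) -` U i" by blast
  have "iter T (i * (n + k)) (iter T m x) \<in> U i" if "i \<in> I" for i
  proof -
    have "iter T (i * (n + k)) (iter T m x) = iter T (m + i * n) (iter T (i * k) x)"
      by (rule iter_collect) (simp add: algebra_simps)
    then show ?thesis using xk that by simp
  qed
  then show "\<exists>x n. \<forall>i\<in>I. iter T (i * n) x \<in> U i" by blast
qed

text \<open>Progressions converging to \<open>f\<close> on \<open>I\<close> also have, by
  compactness, a limit at coordinate \<open>l\<close>.\<close>

lemma prog_extend: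
  assumes I: "finite I" and f: "prog I f" and l: "l \<notin> I"
  shows "\<exists>x. prog (insert l I) (f(l := x))"
proof -
  have "\<exists>G :: ('a \<times> int) filter. ultra G \<and> (\<forall>i\<in>I. ((\<lambda>z. iter T (i * snd z) (fst z)) \<longlongrightarrow> f i) G)"
  proof (rule ex_ultra_lim_finite[OF I])
    fix U assume "\<forall>i\<in>I. open (U i) \<and> f i \<in> U i"
    from progD[OF f this] show "\<exists>z. \<forall>i\<in>I. iter T (i * snd z) (fst z) \<in> U i" by auto
  qed
  then obtain G :: "('a \<times> int) filter" where G: "ultra G"
    "\<And>i. i \<in> I \<Longrightarrow> ((\<lambda>z. iter T (i * snd z) (fst z)) \<longlongrightarrow> f i) G" by blast
  obtain x where x: "((\<lambda>z. iter T (l * snd z) (fst z)) \<longlongrightarrow> x) G"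
    using ultra_compact_lim[OF G(1) compact_UNIV, of "\<lambda>z. iter T (l * snd z) (fst z)"] by auto
  have "prog (insert l I) (f(l := x))"
  proof (rule prog_lim)
    show "\<forall>\<^sub>F z in G. prog (insert l I) (\<lambda>i. iter T (i * snd z) (fst z))"
    proof (intro always_eventually allI)
      fix z :: "'a \<times> int"
      show "prog (insert l I) (\<lambda>i. iter T (i * snd z) (fst z))"
        using prog_shift[OF prog_diag[of "insert l I" "fst z"], of 0 "snd z"] by simp
    qed
    show "((\<lambda>z. iter T (i * snd z) (fst z)) \<longlongrightarrow> (f(l := x)) i) G" if "i \<in> insert l I" for i
      using that x G(2) by (cases "i = l") auto
  qed (use I G(1) ultra_nonbot in auto)
  then show ?thesis by blast
qed

lemma closed_prog_coord:
  assumes "l \<in> I"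
  shows "closed {x. prog I (f(l := x))}"
proof -
  have "\<exists>V. open V \<and> x \<in> V \<and> V \<subseteq> - {x. prog I (f(l := x))}" if x: "\<not> prog I (f(l := x))" for x
  proof -
    obtain U where U: "\<forall>i\<in>I. open (U i) \<and> (f(l := x)) i \<in> U i"
      "\<not> (\<exists>x n. \<forall>i\<in>I. iter T (i * n) x \<in> U i)"
      using x unfolding prog_def by blast
    have "\<not> prog I (f(l := z))" if "z \<in> U l" for z
    proof
      assume p: "prog I (f(l := z))"
      have "\<forall>i\<in>I. open (U i) \<and> (f(l := z)) i \<in> U i" using U(1) that by auto
      from progD[OF p this] show False using U(2) by blast
    qed
    then show ?thesis using U(1) assms by (intro exI[of _ "U l"]) auto
  qed
  then show ?thesis unfolding closed_def by (subst open_subopen) auto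
qed

end

section \<open>Minimality of this closure under the action of \<int> \<times> \<int>\<close>

context ric_ext
begin

text \<open>A progression close to \<open>g\<close> starts at some \<open>z\<close>; minimality
  replaces \<open>z\<close> by a point of the orbit of \<open>x\<close>.\<close>

lemma prog_near_diag:
  assumes I: "finite I" and g: "X.prog I g" and U: "\<forall>i\<in>I. open (U i) \<and> g i \<in> U i"
  shows "\<exists>m n. \<forall>i\<in>I. iter T (m + i * n) x \<in> U i"
proof -
  obtain z n where z: "\<forall>i\<in>I. iter T (i * n) z \<in> U i" using X.progD[OF g U] by blast
  define V where "V = (\<Inter>i\<in>I. iter T (i * n) -` U i)"
  have "open V" unfolding V_def using I U X.open_vimage_iter by blast
  moreover have "z \<in> V \<inter> closure (range (\<lambda>n. iter T n x))" using z minT by (simp add: V_def)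
  ultimately have "V \<inter> range (\<lambda>n. iter T n x) \<noteq> {}"
    using open_Int_closure_eq_empty[of V "range (\<lambda>n. iter T n x)"] by blast
  then obtain m where "iter T m x \<in> V" by blast
  then have "\<forall>i\<in>I. iter T (i * n) (iter T m x) \<in> U i" by (simp add: V_def)
  then have "\<forall>i\<in>I. iter T (m + i * n) x \<in> U i"
    by (simp add: add.commute[of m] X.iter_add)
  then show ?thesis by blast
qed

text \<open>
  Glasner's argument: an idempotent \<open>e\<close> of the ultrafilters on \<open>\<int>\<^sup>2\<close> below \<open>w + u\<close> projects, for
  every \<open>i\<close>, to an idempotent in the minimal left ideal of \<open>u\<close>, whence \<open>u + e\<^sub>i = u\<close>.
\<close>

lemma prog_to_diag:
  assumes I: "finite I" and f: "X.prog I f"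
  shows "\<exists>x. \<forall>V. open V \<longrightarrow> x \<in> V \<longrightarrow> (\<exists>m n. \<forall>i\<in>I. iter T (m + i * n) (f i) \<in> V)"
proof -
  obtain M u y0 where M: "minimal_left_ideal M" and u: "u \<in> M" "uadd u u = u" using ric_data by metis
  note uu = mli_ultra[OF M u(1)]
  obtain x1 :: 'a where True by blast
  define x where "x = X.act u x1"
  have ux: "X.act u x = x" using uu u(2) by (simp add: x_def flip: X.act_uadd)
  \<comment> \<open>The homomorphism through which (m, n) acts on coordinate
    \<open>i\<close>.\<close>
  define h where "h = (\<lambda>i (z :: int \<times> int). fst z + i * snd z)"
  have h_add: "h i (a + b) = h i a + h i b" for i a b by (simp add: h_def algebra_simps)
  have "\<exists>w :: (int \<times> int) filter. ultra w \<and> (\<forall>i\<in>I. ((\<lambda>z. iter T (h i z) x) \<longlongrightarrow> f i) w)"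
  proof (rule ex_ultra_lim_finite[OF I])
    fix U assume "\<forall>i\<in>I. open (U i) \<and> f i \<in> U i"
    from prog_near_diag[OF I f this] obtain m n where "\<forall>i\<in>I. iter T (m + i * n) x \<in> U i" by blast
    then show "\<exists>z. \<forall>i\<in>I. iter T (h i z) x \<in> U i" by (intro exI[of _ "(m, n)"]) (simp add: h_def)
  qed
  then obtain w :: "(int \<times> int) filter" where w: "ultra w"
    "\<And>i. i \<in> I \<Longrightarrow> ((\<lambda>z. iter T (h i z) x) \<longlongrightarrow> f i) w" by blast
  have wi: "X.act (filtermap (h i) w) x = f i" if "i \<in> I" for i
    using w(2)[OF that] ultra_filtermap[OF w(1)] by (intro act_eqI) (auto simp: filterlim_filtermap)
  \<comment> \<open>The idempotent \<open>u\<close> placed in the diagonal direction: every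
    \<open>h i\<close> projects it to \<open>u\<close>.\<close>
  define \<iota> where "\<iota> = filtermap (\<lambda>m :: int. (m, 0 :: int)) u"
  have \<iota>: "ultra \<iota>" unfolding \<iota>_def using uu by (rule ultra_filtermap)
  have \<iota>i: "filtermap (h i) \<iota> = u" for i by (simp add: \<iota>_def filtermap_filtermap h_def)
  define d where "d = uadd w \<iota>"
  have d: "ultra d" unfolding d_def using w(1) \<iota> by (rule ultra_uadd)
  have "\<exists>e. ultra e \<and> e \<le> uadd top d \<and> uadd e e = e"
  proof (rule Ellis_idempotent)
    have "top \<noteq> (bot :: (int \<times> int) filter)"
    proof
      assume "top = (bot :: (int \<times> int) filter)"
      then have "d \<le> bot" using top_greatest[of d] by simp
      then show False using ultra_nonbot[OF d] le_bot[of d] by simp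
    qed
    then show "uadd top d \<noteq> bot" using ultra_nonbot[OF d] by (rule uadd_nonbot)
    fix p q :: "(int \<times> int) filter" assume pq: "ultra p" "ultra q" "q \<le> uadd top d"
    obtain q' where q': "ultra q'" "q = uadd q' d" using ultra_le_uaddE[OF pq(2) d pq(3)] by blast
    have "uadd p q = uadd (uadd p q') d" by (simp add: q'(2) uadd_assoc)
    also have "\<dots> \<le> uadd top d" by (intro uadd_mono) auto
    finally show "uadd p q \<le> uadd top d" .
  qed
  then obtain e where e: "ultra e" "e \<le> uadd top d" "uadd e e = e" by blast
  obtain q where q: "ultra q" "e = uadd q d" using ultra_le_uaddE[OF e(1) d e(2)] by blast
  \<comment> \<open>On coordinate \<open>i\<close> the idempotent \<open>e\<close> reads q + w + u.
    Since \<open>u\<close> absorbs it and fixes \<open>x\<close>, while \<open>w\<close> takes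
    \<open>x\<close> to \<open>f i\<close>, the rest u + q takes \<open>f i\<close> back to
    \<open>x\<close>.\<close>
  define G where "G = uadd \<iota> q"
  have G: "ultra G" unfolding G_def using \<iota> q(1) by (rule ultra_uadd)
  have Gi: "X.act (filtermap (h i) G) (f i) = x" if i: "i \<in> I" for i
  proof -
    note uq = ultra_filtermap[OF q(1), of "h i"] and uw = ultra_filtermap[OF w(1), of "h i"]
    have ei: "filtermap (h i) e = uadd (filtermap (h i) q) (uadd (filtermap (h i) w) u)"
      by (simp add: q(2) d_def filtermap_uadd[where h = "h i", OF h_add] \<iota>i)
    have eM: "filtermap (h i) e \<in> M"
      unfolding ei using mli_left[OF M] uq uw u(1) by blast
    have "uadd (filtermap (h i) e) (filtermap (h i) e) = filtermap (h i) e"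
      using e(3) by (simp flip: filtermap_uadd[where h = "h i", OF h_add])
    from mli_right_id[OF M eM this u(1)] have ue: "uadd u (filtermap (h i) e) = u" .
    have "x = X.act (uadd u (filtermap (h i) e)) x" using ue ux by simp
    also have "\<dots> = X.act u (X.act (filtermap (h i) q) (X.act (filtermap (h i) w) (X.act u x)))"
      unfolding ei using uu uq uw by (simp add: X.act_uadd ultra_uadd)
    also have "\<dots> = X.act (uadd u (filtermap (h i) q)) (f i)"
      using uu uq by (simp add: ux wi[OF i] X.act_uadd)
    also have "uadd u (filtermap (h i) q) = filtermap (h i) G"
      by (simp add: G_def filtermap_uadd[where h = "h i", OF h_add] \<iota>i)
    finally show ?thesis by simp
  qed
  have "\<exists>m n. \<forall>i\<in>I. iter T (m + i * n) (f i) \<in> V" if V: "open V" "x \<in> V" for V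
  proof -
    have "\<forall>\<^sub>F z in G. \<forall>i\<in>I. iter T (h i z) (f i) \<in> V"
    proof (intro eventually_ball_finite[OF I] ballI)
      fix i assume i: "i \<in> I"
      have "\<forall>\<^sub>F k in filtermap (h i) G. iter T k (f i) \<in> V"
        using topological_tendstoD[OF X.act_lim[OF ultra_filtermap[OF G, of "h i"], of "f i"] V(1)] Gi[OF i] V(2)
        by simp
      then show "\<forall>\<^sub>F z in G. iter T (h i z) (f i) \<in> V" by (simp add: eventually_filtermap)
    qed
    then obtain z where "\<forall>i\<in>I. iter T (h i z) (f i) \<in> V"
      using eventually_happens'[OF ultra_nonbot[OF G]] by blast
    then show ?thesis by (auto simp: h_def)
  qed
  then show ?thesis by blast
qed

text \<open>The route from \<open>f\<close> to \<open>g\<close> passes near a diagonal point, whose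
  orbit is dense in the closure.\<close>

lemma prog_minimal:
  assumes I: "finite I" and f: "X.prog I f" and g: "X.prog I g"
    and U: "\<forall>i\<in>I. open (U i) \<and> g i \<in> U i"
  shows "\<exists>m n. \<forall>i\<in>I. iter T (m + i * n) (f i) \<in> U i"
proof -
  obtain x where x: "\<forall>V. open V \<longrightarrow> x \<in> V \<longrightarrow> (\<exists>m n. \<forall>i\<in>I. iter T (m + i * n) (f i) \<in> V)"
    using prog_to_diag[OF I f] by (rule exE)
  obtain m n where mn: "\<forall>i\<in>I. iter T (m + i * n) x \<in> U i" using prog_near_diag[OF I g U] by blast
  define V where "V = (\<Inter>i\<in>I. iter T (m + i * n) -` U i)"
  have "open V" unfolding V_def using I U X.open_vimage_iter by blast
  moreover have "x \<in> V" using mn by (simp add: V_def)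
  ultimately obtain m' n' where mn': "\<forall>i\<in>I. iter T (m' + i * n') (f i) \<in> V" using x by blast
  have "iter T ((m + m') + i * (n + n')) (f i) \<in> U i" if i: "i \<in> I" for i
  proof -
    have "iter T ((m + m') + i * (n + n')) (f i) = iter T (m + i * n) (iter T (m' + i * n') (f i))"
      by (rule X.iter_collect1) (simp add: algebra_simps)
    then show ?thesis using mn' i by (simp add: V_def)
  qed
  then show ?thesis by blast
qed

text \<open>Let \<open>f1\<close> be a limit of progressions whose step tends to infinity. Some
  fixed shift takes \<open>f1\<close> close to \<open>f\<close>, and it takes progressions with
  arbitrarily large step there as well.\<close>

lemma prog_positive:
  assumes I: "finite I" and f: "X.prog I f" and U: "\<forall>i\<in>I. open (U i) \<and> f i \<in> U i"
  shows "\<exists>x n. 1 \<le> n \<and> (\<forall>i\<in>I. iter T (i * n) x \<in> U i)"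
proof -
  obtain p :: "int filter" where p: "ultra p" "p \<le> at_top"
    using ex_ultra_le[OF trivial_limit_at_top_linorder] by blast
  obtain x0 :: 'a where True by blast
  define f1 where "f1 = (\<lambda>i. X.act (filtermap ((*) i) p) x0)"
  have lim: "((\<lambda>k. iter T (i * k) x0) \<longlongrightarrow> f1 i) p" for i
    using X.act_lim[OF ultra_filtermap[OF p(1), of "(*) i"], of x0] by (simp add: f1_def filterlim_filtermap)
  have "X.prog I f1"
  proof (rule X.prog_lim[OF I ultra_nonbot[OF p(1)] _ lim])
    show "\<forall>\<^sub>F k in p. X.prog I (\<lambda>i. iter T (i * k) x0)"
    proof (intro always_eventually allI)
      fix k show "X.prog I (\<lambda>i. iter T (i * k) x0)"
        using X.prog_shift[OF X.prog_diag[of I x0], of 0 k] by simp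
    qed
  qed
  from prog_minimal[OF I this f U] obtain m n where mn: "\<forall>i\<in>I. iter T (m + i * n) (f1 i) \<in> U i" by blast
  have "\<forall>\<^sub>F k in p. \<forall>i\<in>I. iter T (m + i * n) (iter T (i * k) x0) \<in> U i"
    using mn U by (intro eventually_ball_finite[OF I] ballI topological_tendstoD[OF X.tendsto_iter[OF lim]]) auto
  \<comment> \<open>The resulting step is \<open>n + k\<close>, and \<open>n\<close> may be
    negative.\<close>
  moreover have "\<forall>\<^sub>F k in p. 1 - n \<le> k" by (rule filter_leD[OF p(2) eventually_ge_at_top])
  ultimately have "\<forall>\<^sub>F k in p. (\<forall>i\<in>I. iter T (m + i * n) (iter T (i * k) x0) \<in> U i) \<and> 1 - n \<le> k"
    by (rule eventually_conj)
  then obtain k where k: "\<forall>i\<in>I. iter T (m + i * n) (iter T (i * k) x0) \<in> U i" "1 - n \<le> k"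
    using eventually_happens'[OF ultra_nonbot[OF p(1)]] by blast
  have "iter T (i * (n + k)) (iter T m x0) \<in> U i" if i: "i \<in> I" for i
  proof -
    have "iter T (i * (n + k)) (iter T m x0) = iter T (m + i * n) (iter T (i * k) x0)"
      by (rule X.iter_collect) (simp add: algebra_simps)
    then show ?thesis using k(1) i by auto
  qed
  then show ?thesis using k(2) by (intro exI[of _ "iter T m x0"] exI[of _ "n + k"]) auto
qed

end

section \<open>Progressions and fibres\<close>

context wm_ext
begin

lemma prog_swap:
  assumes "finite I" "X.prog I f" "j \<in> I" "\<pi> a = \<pi> (f j)"
  shows "X.prog I (f(j := a))"
  using assms
proof (induction I arbitrary: f a j rule: finite_psubset_induct)
  case (psubset I)
  note I = psubset.hyps(1)
  show ?case
  proof (cases "I = {j}")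
    case True
    show ?thesis
      unfolding True using X.prog_diag[of "{j}" a] by (rule X.prog_cong) simp
  next
    case False
    then obtain l where l: "l \<in> I" "l \<noteq> j" using psubset.prems(2) by blast
    obtain w where w: "min_idem w" using ex_min_idem by blast
    note wu = min_idem_ultra[OF w]
    have ww: "uadd w w = w" using w by (simp add: min_idem_def)
    define c where "c = j - l"
    have c: "c \<noteq> 0" using l(2) by (simp add: c_def)
    define v where "v = filtermap (\<lambda>k. k div c) w"
    note v = idempotent_unscale[OF wu ww c, folded v_def]
    obtain x0 :: 'a where True by blast
    \<comment> \<open>A tuple fixed coordinatewise by the action of T^(i-l) along \<open>v\<close>.
      It is a limit of shifted diagonal points, hence in the closure, and at \<open>j\<close> it is
      fixed by \<open>w\<close>.\<close>
    define f0 where "f0 = (\<lambda>i. X.act (filtermap ((*) (i - l)) v) x0)"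
    have lim0: "((\<lambda>n. iter T ((i - l) * n) x0) \<longlongrightarrow> f0 i) v" for i
      using X.act_lim[OF ultra_filtermap[OF v(1), of "(*) (i - l)"], of x0]
      by (simp add: f0_def filterlim_filtermap)
    have fixed: "X.act (filtermap ((*) (i - l)) v) (f0 i) = f0 i" for i
      using ultra_filtermap[OF v(1), of "(*) (i - l)"] idempotent_scale[OF v(2), of "i - l"]
      by (simp add: f0_def flip: X.act_uadd)
    have lim_fixed: "((\<lambda>n. iter T ((i - l) * n) (f0 i)) \<longlongrightarrow> f0 i) v" for i
      using X.act_lim[OF ultra_filtermap[OF v(1), of "(*) (i - l)"], of "f0 i"]
      by (simp add: fixed filterlim_filtermap)
    have f0: "X.prog I f0"
    proof (rule X.prog_lim[OF I ultra_nonbot[OF v(1)] _ lim0])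
      show "\<forall>\<^sub>F n in v. X.prog I (\<lambda>i. iter T ((i - l) * n) x0)"
      proof (intro always_eventually allI)
        fix n
        show "X.prog I (\<lambda>i. iter T ((i - l) * n) x0)"
          using X.prog_shift[OF X.prog_diag[of I x0], of "- l * n" n] by (simp add: algebra_simps)
      qed
    qed
    define y where "y = \<pi> (f0 j)"
    have wf: "X.act w (f0 j) = f0 j" using fixed[of j] v(3) by (simp add: c_def)
    then have wy: "Y.act w y = y" using pi_act[OF wu, of "f0 j"] by (simp add: y_def)
    define \<Psi> where "\<Psi> = (\<lambda>x a. X.prog I (f0(j := a, l := x)))"
    have lim: "\<Psi> x a" if G: "ultra G" "filtermap fst G = w"
      and ev: "\<forall>\<^sub>F g in G. \<Psi> (\<xi> g) (snd g)"
      and a: "((\<lambda>g. iter T (fst g) (snd g)) \<longlongrightarrow> a) G" and x: "(\<xi> \<longlongrightarrow> x) G" for G \<xi> a x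
    proof -
      \<comment> \<open>Shifting by (-l N, N) leaves coordinate \<open>l\<close> alone and moves
        coordinate \<open>j\<close> by \<open>c * N g\<close>, which is the given
        \<open>fst g\<close> as \<open>c\<close> divides it. The other coordinates converge to their
        fixed values along \<open>v\<close>.\<close>
      define N where "N = (\<lambda>g :: int \<times> 'a. fst g div c)"
      have "\<forall>\<^sub>F g in G. c dvd fst g"
        using idempotent_dvd[OF wu ww c] unfolding G(2)[symmetric] by (simp add: eventually_filtermap)
      then have cN: "\<forall>\<^sub>F g in G. c * N g = fst g" by (rule eventually_mono) (simp add: N_def)
      have Nv: "filtermap N G = v" by (simp add: N_def v_def filtermap_filtermap flip: G(2))
      show ?thesis
        unfolding \<Psi>_def
      proof (rule X.prog_lim[OF I ultra_nonbot[OF G(1)]])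
        show "\<forall>\<^sub>F g in G. X.prog I (\<lambda>i. iter T (- l * N g + i * N g) ((f0(j := snd g, l := \<xi> g)) i))"
          using ev by (rule eventually_mono) (unfold \<Psi>_def, rule X.prog_shift)
        fix i assume "i \<in> I"
        have sc: "- l * N g + i * N g = (i - l) * N g" for g by (simp add: algebra_simps)
        consider "i = l" | "i = j" | "i \<noteq> l" "i \<noteq> j" by blast
        then show "((\<lambda>g. iter T (- l * N g + i * N g) ((f0(j := snd g, l := \<xi> g)) i))
            \<longlongrightarrow> (f0(j := a, l := x)) i) G"
          unfolding sc
        proof cases
          case 1
          then show "((\<lambda>g. iter T ((i - l) * N g) ((f0(j := snd g, l := \<xi> g)) i))
            \<longlongrightarrow> (f0(j := a, l := x)) i) G" using x by simp
        next
          case 2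
          have "((\<lambda>g. iter T (c * N g) (snd g)) \<longlongrightarrow> a) G"
          proof (rule Lim_transform_eventually[OF a])
            show "\<forall>\<^sub>F g in G. iter T (fst g) (snd g) = iter T (c * N g) (snd g)"
              using cN by (rule eventually_mono) simp
          qed
          then show "((\<lambda>g. iter T ((i - l) * N g) ((f0(j := snd g, l := \<xi> g)) i))
            \<longlongrightarrow> (f0(j := a, l := x)) i) G" using 2 l(2) by (simp add: c_def)
        next
          case 3
          have "((\<lambda>g. iter T ((i - l) * N g) (f0 i)) \<longlongrightarrow> f0 i) G"
            using lim_fixed[of i] by (simp add: filterlim_filtermap flip: Nv)
          then show "((\<lambda>g. iter T ((i - l) * N g) ((f0(j := snd g, l := \<xi> g)) i))
            \<longlongrightarrow> (f0(j := a, l := x)) i) G" using 3 by simp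
        qed
      qed
    qed
    have "\<exists>x. \<forall>a\<in>fixpts w y. \<Psi> x a"
    proof (rule uniform_choice[OF w wy])
      fix a assume a: "a \<in> fixpts w y"
      \<comment> \<open>Dropping \<open>l\<close> makes the induction hypothesis available;
        \<open>prog_extend\<close> then restores some entry there.\<close>
      have "X.prog (I - {l}) (f0(j := a))"
      proof (rule psubset.IH)
        show "I - {l} \<subset> I" using l(1) by blast
        show "X.prog (I - {l}) f0" using f0 by (rule X.prog_subset) blast
        show "j \<in> I - {l}" using psubset.prems(2) l(2) by blast
        show "\<pi> a = \<pi> (f0 j)" using a by (simp add: fixpts_def y_def)
      qed
      then have "\<exists>x. X.prog (insert l (I - {l})) (f0(j := a, l := x))"
        using I by (intro X.prog_extend) auto
      then show "\<exists>x. \<Psi> x a" using l(1) by (simp add: \<Psi>_def insert_absorb)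
    next
      show "closed {x. \<Psi> x a}" for a
        unfolding \<Psi>_def using l(1) by (rule X.closed_prog_coord)
    qed (rule lim)
    then obtain x where x: "\<And>a. a \<in> fixpts w y \<Longrightarrow> \<Psi> x a" by blast
    \<comment> \<open>By RIC every point of the fibre is a limit of \<open>w\<close>-fixed points,
      all of which share the entry \<open>x\<close>.\<close>
    have full: "\<Psi> x a" if a: "\<pi> a = y" for a
    proof -
      obtain G where G: "ultra G" "filtermap fst G = w" "\<forall>\<^sub>F g in G. snd g \<in> fixpts w y"
        "((\<lambda>g. iter T (fst g) (snd g)) \<longlongrightarrow> a) G"
        using lsup_ultra[OF wu fiber_lsup[OF w wy a]] by blast
      have "\<forall>\<^sub>F g in G. \<Psi> x (snd g)" using G(3) by (rule eventually_mono) (rule x)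
      from lim[OF G(1,2) this G(4) tendsto_const] show ?thesis .
    qed
    define f' where "f' = f0(l := x)"
    have f'j: "f' j = f0 j" using l(2) by (simp add: f'_def)
    have f'_swap: "X.prog I (f'(j := b))" if "\<pi> b = y" for b
      using full[OF that] l(2) by (simp add: \<Psi>_def f'_def fun_upd_twist)
    have "f'(j := f0 j) = f'" using f'j by (auto simp: fun_eq_iff)
    then have f': "X.prog I f'" using f'_swap[of "f0 j"] by (simp add: y_def)
    show ?thesis
      unfolding X.prog_def
    proof (intro allI impI)
      fix U assume U: "\<forall>i\<in>I. open (U i) \<and> (f(j := a)) i \<in> U i"
      \<comment> \<open>At \<open>j\<close> only the fibre is prescribed; the saturation is open
        because \<pi> is. A shift of \<open>f'\<close> enters these sets, and its entry at
        \<open>j\<close> is then replaced inside its fibre by a point of \<open>U j\<close>, pulled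
        back to \<open>b'\<close> before the shift.\<close>
      define U' where "U' = U(j := \<pi> -` (\<pi> ` U j))"
      have U': "\<forall>i\<in>I. open (U' i) \<and> f i \<in> U' i"
      proof
        fix i assume i: "i \<in> I"
        show "open (U' i) \<and> f i \<in> U' i"
        proof (cases "i = j")
          case True
          have "open (U j)" "a \<in> U j" using U i True by auto
          then have "open (\<pi> -` (\<pi> ` U j))" "f j \<in> \<pi> -` (\<pi> ` U j)"
            using open_vimage_pi[OF open_pi] imageI[of a "U j" \<pi>] psubset.prems(3) by simp_all
          then show ?thesis using True by (simp add: U'_def)
        next
          case False
          then show ?thesis using bspec[OF U i] by (simp add: U'_def)
        qed
      qed
      obtain m n where mn: "\<forall>i\<in>I. iter T (m + i * n) (f' i) \<in> U' i"
        using prog_minimal[OF I f' psubset.prems(1) U'] by blast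
      have "iter T (m + j * n) (f' j) \<in> \<pi> -` (\<pi> ` U j)"
        using mn psubset.prems(2) by (auto simp: U'_def)
      then obtain b where b: "b \<in> U j" "\<pi> b = \<pi> (iter T (m + j * n) (f' j))" by auto
      define b' where "b' = iter T (- (m + j * n)) b"
      have "\<pi> b' = iter S (- (m + j * n)) (iter S (m + j * n) (\<pi> (f' j)))"
        by (simp only: b'_def pi_iter b(2))
      then have "\<pi> b' = y" by (simp only: Y.iter_minus f'j y_def)
      note shifted = X.prog_shift[OF f'_swap[OF this], of m n]
      have "iter T (m + i * n) ((f'(j := b')) i) \<in> U i" if i: "i \<in> I" for i
      proof (cases "i = j")
        case True
        have "iter T (m + j * n) b' = b" unfolding b'_def by (rule X.iter_minus)
        then show ?thesis using True b(1) by simp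
      next
        case False
        then show ?thesis using mn i by (auto simp: U'_def)
      qed
      then have "\<forall>i\<in>I. open (U i) \<and> iter T (m + i * n) ((f'(j := b')) i) \<in> U i" using U by blast
      from X.progD[OF shifted this] show "\<exists>x n. \<forall>i\<in>I. iter T (i * n) x \<in> U i" .
    qed
  qed
qed

lemma prog_saturated:
  assumes I: "finite I" and f: "X.prog I f" and g: "\<And>i. i \<in> I \<Longrightarrow> \<pi> (g i) = \<pi> (f i)"
  shows "X.prog I g"
proof -
  have "X.prog I (\<lambda>i. if i \<in> J then g i else f i)" if "finite J" "J \<subseteq> I" for J
    using that
  proof (induction J)
    case empty
    then show ?case using f by simp
  next
    case (insert j J)
    have j: "j \<in> I" using insert.prems by blast
    have "X.prog I ((\<lambda>i. if i \<in> J then g i else f i)(j := g j))"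
    proof (rule prog_swap[OF I _ j])
      show "X.prog I (\<lambda>i. if i \<in> J then g i else f i)" using insert by blast
      show "\<pi> (g j) = \<pi> (if j \<in> J then g j else f j)" using g[OF j] by simp
    qed
    then show ?case by (rule X.prog_cong) auto
  qed
  from this[OF I] have "X.prog I (\<lambda>i. if i \<in> I then g i else f i)" by blast
  then show ?thesis by (rule X.prog_cong) simp
qed

section \<open>Recurrence in fibres and genericity\<close>

lemma fiber_recurrence:
  assumes I: "finite I" and U: "\<And>i. i \<in> I \<Longrightarrow> open (U i) \<and> y \<in> \<pi> ` U i"
  shows "\<exists>x n. 1 \<le> n \<and> (\<forall>i\<in>I. iter T (i * n) x \<in> U i)"
proof -
  obtain g where g: "\<forall>i\<in>I. g i \<in> U i \<and> \<pi> (g i) = y"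
    using bchoice[of I "\<lambda>i x. x \<in> U i \<and> \<pi> x = y"] U by blast
  obtain x where x: "\<pi> x = y" using surj_pi by (metis surjD)
  \<comment> \<open>A constant tuple in the fibre is a progression, and saturation changes its
    entries to those of \<open>g\<close>.\<close>
  have "X.prog I g"
    using I X.prog_diag[of I x] by (rule prog_saturated) (use g x in simp)
  then show ?thesis using U g by (intro prog_positive[OF I]) auto
qed

text \<open>
  A fibre that avoids all \<open>bad Us\<close> returns along \<open>Us\<close> as soon as it meets every set in \<open>Us\<close>; the
  closure makes \<open>bad Us\<close> closed.
\<close>

definition bad :: "'a set list \<Rightarrow> 'a set" where
  "bad Us = closure (\<pi> -` (\<Inter>V\<in>set Us. \<pi> ` V)) -
     \<pi> -` (\<pi> ` {z. \<exists>n\<ge>1. \<forall>i<length Us. iter T (int i * n) z \<in> Us ! i})"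

lemma open_good:
  assumes "\<forall>V\<in>set Us. open V"
  shows "open (- bad Us)"
proof -
  let ?W = "\<lambda>n. \<Inter>i<length Us. iter T (int i * n) -` (Us ! i)"
  have "{z. \<exists>n\<ge>1. \<forall>i<length Us. iter T (int i * n) z \<in> Us ! i} = (\<Union>n\<in>{1..}. ?W n)" by auto
  moreover have "open (?W n)" for n
    using assms by (intro open_INT ballI X.open_vimage_iter) auto
  ultimately have "open {z. \<exists>n\<ge>1. \<forall>i<length Us. iter T (int i * n) z \<in> Us ! i}" by auto
  then have "open (\<pi> -` (\<pi> ` {z. \<exists>n\<ge>1. \<forall>i<length Us. iter T (int i * n) z \<in> Us ! i}))"
    by (intro open_vimage_pi open_pi)
  then have "closed (bad Us)" unfolding bad_def by (intro closed_Diff closed_closure)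
  then show ?thesis by (rule open_Compl)
qed

text \<open>If \<open>O'\<close> misses the points whose fibre meets all of \<open>Us\<close>, it
  misses the closure of that set. Otherwise recurrence is applied to the sets cut down to the
  saturation of \<open>O'\<close>.\<close>

lemma good_dense:
  assumes Us: "\<forall>V\<in>set Us. open V" "Us \<noteq> []" and O: "open O'" "O' \<noteq> {}"
  shows "- bad Us \<inter> O' \<noteq> {}"
proof (cases "O' \<inter> \<pi> -` (\<Inter>V\<in>set Us. \<pi> ` V) = {}")
  case True
  then have "O' \<inter> closure (\<pi> -` (\<Inter>V\<in>set Us. \<pi> ` V)) = {}"
    using open_Int_closure_eq_empty[OF O(1)] by blast
  then show ?thesis using O(2) by (auto simp: bad_def)
next
  case False
  then obtain x where x: "x \<in> O'" "\<And>V. V \<in> set Us \<Longrightarrow> \<pi> x \<in> \<pi> ` V" by blast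
  define U where "U = (\<lambda>i :: int. Us ! nat i \<inter> \<pi> -` (\<pi> ` O'))"
  have opn: "open (\<pi> -` (\<pi> ` O'))" using O(1) by (intro open_vimage_pi open_pi)
  have "\<exists>z n. 1 \<le> n \<and> (\<forall>i\<in>{0..<int (length Us)}. iter T (i * n) z \<in> U i)"
  proof (rule fiber_recurrence)
    fix i assume "i \<in> {0..<int (length Us)}"
    then have i: "Us ! nat i \<in> set Us" by (auto simp: nat_less_iff intro: nth_mem)
    then obtain z where "z \<in> Us ! nat i" "\<pi> z = \<pi> x" using x(2)[OF i] by auto
    moreover from this have "z \<in> U i" using x(1) imageI[of x O' \<pi>] by (simp add: U_def)
    ultimately have "\<pi> x \<in> \<pi> ` U i" using imageI[of z "U i" \<pi>] by simp
    then show "open (U i) \<and> \<pi> x \<in> \<pi> ` U i" using Us(1) i opn by (simp add: U_def open_Int)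
  qed simp
  then obtain z n where z: "1 \<le> n" "\<And>i. i \<in> {0..<int (length Us)} \<Longrightarrow> iter T (i * n) z \<in> U i" by blast
  have "iter T (int i * n) z \<in> Us ! i" if "i < length Us" for i
    using z(2)[of "int i"] that by (simp add: U_def)
  then have zin: "z \<in> {z. \<exists>n\<ge>1. \<forall>i<length Us. iter T (int i * n) z \<in> Us ! i}" using z(1) by blast
  \<comment> \<open>The term with index 0 is unshifted, so the starting point itself lies over the
    image of \<open>O'\<close>.\<close>
  have "z \<in> \<pi> -` (\<pi> ` O')" using z(2)[of 0] Us(2) by (simp add: U_def)
  then obtain x' where x': "x' \<in> O'" "\<pi> x' = \<pi> z" by auto
  then have "x' \<notin> bad Us" using zin by (auto simp: bad_def)
  then show ?thesis using x'(1) by blast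
qed

lemma Delta_transitive_fiber:
  assumes B: "\<And>Q x. open Q \<Longrightarrow> x \<in> Q \<Longrightarrow> \<exists>B\<in>\<B>. x \<in> B \<and> B \<subseteq> Q"
    and x: "\<And>Us. set Us \<subseteq> \<B> \<Longrightarrow> Us \<noteq> [] \<Longrightarrow> x \<notin> bad Us"
  shows "Delta_transitive_set T (\<pi> -` {\<pi> x})"
  unfolding Delta_transitive_set_def
proof (intro conjI allI impI)
  show "closed (\<pi> -` {\<pi> x})" using cont_pi by (intro closed_vimage) auto
  fix d :: nat and U assume "\<forall>i\<le>d. open (U i) \<and> U i \<inter> \<pi> -` {\<pi> x} \<noteq> {}"
  then have U: "\<And>i. i \<le> d \<Longrightarrow> open (U i)" "\<And>i. i \<le> d \<Longrightarrow> \<exists>a\<in>U i. \<pi> a = \<pi> x" by blast+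
  have "\<exists>C\<in>\<B>. \<pi> x \<in> \<pi> ` C \<and> C \<subseteq> U i" if i: "i \<le> d" for i
  proof -
    obtain a where "a \<in> U i" "\<pi> a = \<pi> x" using U(2)[OF i] by blast
    moreover obtain D where "D \<in> \<B>" "a \<in> D" "D \<subseteq> U i" using B[OF U(1)[OF i] \<open>a \<in> U i\<close>] by blast
    ultimately show ?thesis using imageI[of a D \<pi>] by (intro bexI[of _ D]) simp_all
  qed
  then obtain C where C: "\<And>i. i \<le> d \<Longrightarrow> C i \<in> \<B> \<and> \<pi> x \<in> \<pi> ` C i \<and> C i \<subseteq> U i" by metis
  \<comment> \<open>The position in the list is the multiple of the step, so indices up to
    \<open>d\<close> require length \<open>Suc d\<close>.\<close>
  define Us where "Us = map C [0..<Suc d]"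
  have len: "length Us = Suc d" by (simp add: Us_def)
  have nth: "Us ! i = C i" if "i \<le> d" for i
    using that nth_map[of i "[0..<Suc d]" C] nth_upt[of 0 i "Suc d"]
    by (simp add: Us_def del: upt_Suc)
  have V: "V \<in> \<B> \<and> \<pi> x \<in> \<pi> ` V" if "V \<in> set Us" for V
  proof -
    obtain i where "i < length Us" "V = Us ! i" using \<open>V \<in> set Us\<close> by (metis in_set_conv_nth)
    then show ?thesis using C[of i] by (simp add: len nth less_Suc_eq_le)
  qed
  have "Us \<noteq> []" using len by auto
  moreover have "set Us \<subseteq> \<B>" using V by blast
  ultimately have nb: "x \<notin> bad Us" by (intro x)
  have "x \<in> \<pi> -` (\<Inter>V\<in>set Us. \<pi> ` V)" using V by blast
  then have "x \<in> closure (\<pi> -` (\<Inter>V\<in>set Us. \<pi> ` V))" by (rule subsetD[OF closure_subset])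
  \<comment> \<open>Being outside \<open>bad Us\<close> puts a returning point \<open>z\<close> into
    the fibre of \<open>x\<close>, which is the extra demand made at index 0.\<close>
  then have "x \<in> \<pi> -` (\<pi> ` {z. \<exists>n\<ge>1. \<forall>i<length Us. iter T (int i * n) z \<in> Us ! i})"
    using nb unfolding bad_def Diff_iff by simp
  then obtain z where z0: "\<pi> x = \<pi> z" "z \<in> {z. \<exists>n\<ge>1. \<forall>i<length Us. iter T (int i * n) z \<in> Us ! i}"
    unfolding vimage_eq by (rule imageE)
  then obtain n where z: "1 \<le> n" "\<forall>i<length Us. iter T (int i * n) z \<in> Us ! i" by blast
  have it: "iter T (int i * n) z = (T ^^ (i * nat n)) z" for i
    using z(1) by (simp add: iter_def nat_mult_distrib)
  have in_U: "(T ^^ (i * nat n)) z \<in> U i" if "i \<le> d" for i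
  proof -
    have "iter T (int i * n) z \<in> C i" using z(2) that by (simp add: len flip: nth)
    then show ?thesis using C[OF that] it by auto
  qed
  have "z \<in> (\<Inter>i\<le>d. (T ^^ (i * nat n)) -` (U(0 := U 0 \<inter> \<pi> -` {\<pi> x})) i)"
  proof
    fix i assume "i \<in> {..d}"
    then have "(T ^^ (i * nat n)) z \<in> U i" using in_U by simp
    then show "z \<in> (T ^^ (i * nat n)) -` (U(0 := U 0 \<inter> \<pi> -` {\<pi> x})) i"
      using z0(1) by (cases "i = 0") simp_all
  qed
  moreover have "1 \<le> nat n" using z(1) by simp
  ultimately show "return_times T d (U(0 := U 0 \<inter> \<pi> -` {\<pi> x})) \<noteq> {}"
    unfolding return_times_def by blast
qed

end

theorem theorem8p9:
  fixes T :: "'a::metric_space \<Rightarrow> 'a"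
    and S :: "'b::metric_space \<Rightarrow> 'b"
    and \<pi> :: "'a \<Rightarrow> 'b"
  assumes "minimal_tds T" and "minimal_tds S"
    and "nontrivial_extension T S \<pi>"
    and "RIC_extension T S \<pi>"
    and "weakly_mixing_extension T \<pi>"
  shows "\<exists>\<Omega>. gdelta \<Omega> \<and> closure \<Omega> = UNIV \<and>
           (\<forall>x\<in>\<Omega>. Delta_transitive_set T (\<pi> -` {\<pi> x}))"
proof -
  interpret wm_ext T S \<pi>
  proof
    show "tds T" "tds S" "closure (range (\<lambda>n. iter T n x)) = UNIV"
      "closure (range (\<lambda>n. iter S n y)) = UNIV" for x y
      using assms(1,2) unfolding minimal_tds_def by blast+
    show "extension T S \<pi>" using assms(3) unfolding nontrivial_extension_def by blast
  qed (rule assms)+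
  obtain \<B> :: "'a set set" where B: "countable \<B>" "\<And>B. B \<in> \<B> \<Longrightarrow> open B"
    "\<And>Q x. open Q \<Longrightarrow> x \<in> Q \<Longrightarrow> \<exists>B\<in>\<B>. x \<in> B \<and> B \<subseteq> Q"
    using compact_countable_base[OF X.compact_UNIV] by blast
  define L where "L = {Us. set Us \<subseteq> \<B> \<and> Us \<noteq> []}"
  define \<Omega> where "\<Omega> = (\<Inter>Us\<in>L. - bad Us)"
  have "countable (lists \<B>)" using B(1) by (rule countable_lists)
  then have "countable L" by (rule countable_subset[rotated]) (auto simp: L_def)
  have opn: "open (- bad Us)" if "Us \<in> L" for Us
    using that B(2) by (intro open_good) (auto simp: L_def)
  obtain B0 where "B0 \<in> \<B>" using B(3)[of UNIV] by blast
  then have "[B0] \<in> L" by (simp add: L_def)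
  then have ne: "L \<noteq> {}" by blast
  \<comment> \<open>The nonempty countable family \<open>L\<close> is enumerated to present \<Omega>
    as an intersection of a sequence of open sets.\<close>
  have "gdelta (\<Inter>n. - bad (from_nat_into L n))"
    by (intro gdelta.intros opn from_nat_into ne)
  moreover have "\<Omega> = (\<Inter>Us\<in>range (from_nat_into L). - bad Us)"
    unfolding \<Omega>_def using range_from_nat_into[OF ne \<open>countable L\<close>] by simp
  ultimately have "gdelta \<Omega>" by simp
  moreover have "closure \<Omega> = UNIV"
  proof -
    have "\<Omega> \<inter> V \<noteq> {}" if V: "open V" "V \<noteq> {}" for V
    proof -
      have "\<exists>x\<in>V. \<forall>G\<in>(\<lambda>Us. - bad Us) ` L. x \<in> G"
      proof (rule Baire_compact[OF X.compact_UNIV])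
        show "countable ((\<lambda>Us. - bad Us) ` L)" using \<open>countable L\<close> by simp
        show "openin (top_of_set UNIV) V" using V(1) by simp
        fix G assume "G \<in> (\<lambda>Us. - bad Us) ` L"
        then obtain Us where Us: "Us \<in> L" "G = - bad Us" by blast
        show "openin (top_of_set UNIV) G" using opn[OF Us(1)] Us(2) by simp
        fix U :: "'a set" assume "openin (top_of_set UNIV) U" "U \<noteq> {}"
        then show "G \<inter> U \<noteq> {}"
          unfolding Us(2) using Us(1) B(2) by (intro good_dense) (auto simp: L_def)
      qed (rule V(2))
      then show ?thesis by (auto simp: \<Omega>_def)
    qed
    from this[of "- closure \<Omega>"] have "\<Omega> \<inter> - closure \<Omega> \<noteq> {}" if "closure \<Omega> \<noteq> UNIV"
      using that open_Compl[OF closed_closure] by blast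
    then show ?thesis using closure_subset[of \<Omega>] by blast
  qed
  moreover have "\<forall>x\<in>\<Omega>. Delta_transitive_set T (\<pi> -` {\<pi> x})"
  proof
    fix x assume "x \<in> \<Omega>"
    then show "Delta_transitive_set T (\<pi> -` {\<pi> x})"
      by (intro Delta_transitive_fiber[OF B(3)]) (auto simp: \<Omega>_def L_def)
  qed
  ultimately show ?thesis by blast
qed

end
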